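(* Let $\Gamma$ be a countable infinite group and let $\Gamma_0$ be an infinite abelian subgroup of $\Gamma$. Let $M=L(\Gamma)$ and $A=L(\Gamma_0)$. Then the following conditions are equivalent: (1) the action of $\Gamma_0$ by inner automorphisms on $M$ (i.e. the conjugation action of the subgroup $\lambda(\Gamma_0)$ of $U(A)$) is strongly mixing relative to $A$; (2) for every finite subset $C\subset\Gamma\setminus\Gamma_0$ there exists a finite subset $E\subset\Gamma_0$ such that $gg_0h\notin\Gamma_0$ for all $g_0\in\Gamma_0\setminus E$ and all $g,h\in C$; (3) for every almost orthonormal infinite subset $S\subset U(A)$, for all $x,y\in M$ and for every $\varepsilon>0$, there exists a finite subset $F\subset S$ such that $$\|E_A(uxu^*y)-E_A(x)E_A(y)\|_2<\varepsilon\quad\forall u\in S\setminus F;$$ (4) $A$ is strongly mixing in $M$.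
   Context: For a countable group $\Gamma$, $\lambda$ is the left regular representation on $\ell^2(\Gamma)$ and $L(\Gamma)$ is the von Neumann algebra generated by $\lambda(\Gamma)$, equipped with the faithful normal trace $\tau(x)=\langle x\delta_1,\delta_1\rangle$ and the norm $\|x\|_2=\tau(x^*x)^{1/2}$. For a subgroup $\Gamma_0$, $L(\Gamma_0)$ is identified with the von Neumann subalgebra of $L(\Gamma)$ generated by $\lambda(\Gamma_0)$. $E_A$ is the $\tau$-preserving conditional expectation of $M$ onto $A$; $U(A)$ is the unitary group of $A$. Almost orthonormal: let $N$ be a finite von Neumann algebra with separable predual $N_\star$ (the space of normal linear functionals). An infinite subset $S\subset U(N)$ is almost orthonormal if for every $\varphi\in N_\star$ and every $\varepsilon>0$ there exists a finite subset $F\subset S$ such that $|\varphi(u)|\le\varepsilon$ for all $u\in S\setminus F$. Strongly mixing: let $A$ be an abelian unital von Neumann subalgebra of a finite von Neumann algebra $M$ with trace $\tau$ and let $G$ be a subgroup of $U(A)$. The action of $G$ on $M$ by conjugation is strongly mixing relative to $A$ if for all $x,y\in M$, $$\lim_{u\to\infty,\,u\in G}\|E_A(uxu^{-1}y)-E_A(x)E_A(y)\|_2=0,$$ i.e. for every $\varepsilon>0$ the norm is $<\varepsilon$ for all $u\in G$ outside some finite subset. The algebra $A$ is strongly mixing in $M$ if, for every almost orthonormal infinite subgroup $G$ of $U(A)$, the action of $G$ on $M$ by conjugation is strongly mixing relative to $A$. *)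

theory Defs
  imports "HOL-Analysis.Analysis" "HOL-Algebra.Group"
begin

section \<open>The Hilbert space of square-summable families and its bounded operators\<close>

text \<open>
  A vector of $\ell^2(I)$ is a function that vanishes outside \<open>I\<close>, and an operator on $\ell^2(I)$
  is a function that is \<open>undefined\<close> outside \<open>l2 I\<close>. Hence equality in HOL is equality of vectors
  and of operators, also when sets of operators are counted.
\<close>

type_synonym 'i vec = "'i \<Rightarrow> complex"
type_synonym 'i op = "'i vec \<Rightarrow> 'i vec"

definition l2 :: "'i set \<Rightarrow> 'i vec set" where
  "l2 I = {\<xi>. (\<forall>i. i \<notin> I \<longrightarrow> \<xi> i = 0) \<and> (\<lambda>i. (cmod (\<xi> i))\<^sup>2) summable_on I}"

text \<open>The inner product is linear in the first argument.\<close>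

definition l2_inner :: "'i set \<Rightarrow> 'i vec \<Rightarrow> 'i vec \<Rightarrow> complex" where
  "l2_inner I \<xi> \<eta> = (\<Sum>\<^sub>\<infinity>i\<in>I. \<xi> i * cnj (\<eta> i))"

definition l2_norm :: "'i set \<Rightarrow> 'i vec \<Rightarrow> real" where
  "l2_norm I \<xi> = sqrt (\<Sum>\<^sub>\<infinity>i\<in>I. (cmod (\<xi> i))\<^sup>2)"

definition delta :: "'i \<Rightarrow> 'i vec" where
  "delta i = (\<lambda>j. if j = i then 1 else 0)"

definition bounded_ops :: "'i set \<Rightarrow> 'i op set" where
  "bounded_ops I = {T \<in> l2 I \<rightarrow>\<^sub>E l2 I.
     (\<forall>\<xi>\<in>l2 I. \<forall>\<eta>\<in>l2 I. T (\<lambda>i. \<xi> i + \<eta> i) = (\<lambda>i. T \<xi> i + T \<eta> i)) \<and>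
     (\<forall>c. \<forall>\<xi>\<in>l2 I. T (\<lambda>i. c * \<xi> i) = (\<lambda>i. c * T \<xi> i)) \<and>
     (\<exists>K. \<forall>\<xi>\<in>l2 I. l2_norm I (T \<xi>) \<le> K * l2_norm I \<xi>)}"

definition op_one :: "'i set \<Rightarrow> 'i op" where
  "op_one I = (\<lambda>\<xi>\<in>l2 I. \<xi>)"

definition op_mult :: "'i set \<Rightarrow> 'i op \<Rightarrow> 'i op \<Rightarrow> 'i op" where
  "op_mult I S T = compose (l2 I) S T"

definition op_add :: "'i set \<Rightarrow> 'i op \<Rightarrow> 'i op \<Rightarrow> 'i op" where
  "op_add I S T = (\<lambda>\<xi>\<in>l2 I. \<lambda>i. S \<xi> i + T \<xi> i)"

definition op_diff :: "'i set \<Rightarrow> 'i op \<Rightarrow> 'i op \<Rightarrow> 'i op" where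
  "op_diff I S T = (\<lambda>\<xi>\<in>l2 I. \<lambda>i. S \<xi> i - T \<xi> i)"

definition op_scale :: "'i set \<Rightarrow> complex \<Rightarrow> 'i op \<Rightarrow> 'i op" where
  "op_scale I c T = (\<lambda>\<xi>\<in>l2 I. \<lambda>i. c * T \<xi> i)"

definition op_adj :: "'i set \<Rightarrow> 'i op \<Rightarrow> 'i op" where
  "op_adj I T = (THE S. S \<in> bounded_ops I \<and>
     (\<forall>\<xi>\<in>l2 I. \<forall>\<eta>\<in>l2 I. l2_inner I (T \<xi>) \<eta> = l2_inner I \<xi> (S \<eta>)))"

definition op_positive :: "'i set \<Rightarrow> 'i op \<Rightarrow> bool" where
  "op_positive I T \<longleftrightarrow> (\<forall>\<xi>\<in>l2 I. l2_inner I (T \<xi>) \<xi> \<in> \<real>\<^sub>\<ge>\<^sub>0)"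


section \<open>Von Neumann algebras on $\ell^2(I)$\<close>

definition commutant :: "'i set \<Rightarrow> 'i op set \<Rightarrow> 'i op set" where
  "commutant I X = {T \<in> bounded_ops I. \<forall>S\<in>X. op_mult I S T = op_mult I T S}"

definition von_neumann_algebra :: "'i set \<Rightarrow> 'i op set \<Rightarrow> bool" where
  "von_neumann_algebra I N \<longleftrightarrow>
     N \<subseteq> bounded_ops I \<and> (\<forall>T\<in>N. op_adj I T \<in> N) \<and> commutant I (commutant I N) = N"

definition generated_vna :: "'i set \<Rightarrow> 'i op set \<Rightarrow> 'i op set" where
  "generated_vna I X = \<Inter>{N. von_neumann_algebra I N \<and> X \<subseteq> N}"

definition unitary_group :: "'i set \<Rightarrow> 'i op set \<Rightarrow> 'i op monoid" where
  "unitary_group I N =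
     \<lparr>carrier = {u \<in> N. op_mult I (op_adj I u) u = op_one I \<and> op_mult I u (op_adj I u) = op_one I},
      mult = op_mult I, one = op_one I\<rparr>"

definition op_linear_on :: "'i set \<Rightarrow> 'i op set \<Rightarrow> ('i op \<Rightarrow> 'i op) \<Rightarrow> bool" where
  "op_linear_on I N E \<longleftrightarrow>
     (\<forall>x\<in>N. \<forall>y\<in>N. E (op_add I x y) = op_add I (E x) (E y)) \<and>
     (\<forall>c. \<forall>x\<in>N. E (op_scale I c x) = op_scale I c (E x))"

definition functional_on :: "'i set \<Rightarrow> 'i op set \<Rightarrow> ('i op \<Rightarrow> complex) \<Rightarrow> bool" where
  "functional_on I N \<phi> \<longleftrightarrow>
     (\<forall>x\<in>N. \<forall>y\<in>N. \<phi> (op_add I x y) = \<phi> x + \<phi> y) \<and>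
     (\<forall>c. \<forall>x\<in>N. \<phi> (op_scale I c x) = c * \<phi> x)"

text \<open>
  The ultraweak topology is the weakest one for which all functionals
  $T \mapsto \sum_n \langle T\xi_n, \eta_n\rangle$ with $\sum_n \|\xi_n\|^2 < \infty$ and
  $\sum_n \|\eta_n\|^2 < \infty$ are continuous; normal functionals are the ultraweakly
  continuous linear ones.
\<close>

definition ultraweak_topology :: "'i set \<Rightarrow> 'i op topology" where
  "ultraweak_topology I = topology_generated_by
     {{T \<in> bounded_ops I. (\<Sum>n. l2_inner I (T (\<xi> n)) (\<eta> n)) \<in> U} | \<xi> \<eta> U.
        range \<xi> \<subseteq> l2 I \<and> summable (\<lambda>n::nat. (l2_norm I (\<xi> n))\<^sup>2) \<and>
        range \<eta> \<subseteq> l2 I \<and> summable (\<lambda>n::nat. (l2_norm I (\<eta> n))\<^sup>2) \<and> open U}"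

definition predual :: "'i set \<Rightarrow> 'i op set \<Rightarrow> ('i op \<Rightarrow> complex) set" where
  "predual I N = {\<phi>. functional_on I N \<phi> \<and>
     continuous_map (subtopology (ultraweak_topology I) N) euclidean \<phi>}"

definition almost_orthonormal :: "'i set \<Rightarrow> 'i op set \<Rightarrow> 'i op set \<Rightarrow> bool" where
  "almost_orthonormal I N S \<longleftrightarrow>
     infinite S \<and> S \<subseteq> carrier (unitary_group I N) \<and>
     (\<forall>\<phi>\<in>predual I N. \<forall>\<epsilon>>0. \<exists>F. finite F \<and> F \<subseteq> S \<and> (\<forall>u\<in>S - F. cmod (\<phi> u) \<le> \<epsilon>))"


section \<open>Conditional expectations and strong mixing\<close>

definition norm2 :: "'i set \<Rightarrow> ('i op \<Rightarrow> complex) \<Rightarrow> 'i op \<Rightarrow> real" where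
  "norm2 I \<tau> x = sqrt (Re (\<tau> (op_mult I (op_adj I x) x)))"

definition conditional_expectation ::
  "'i set \<Rightarrow> ('i op \<Rightarrow> complex) \<Rightarrow> 'i op set \<Rightarrow> 'i op set \<Rightarrow> ('i op \<Rightarrow> 'i op) \<Rightarrow> bool" where
  "conditional_expectation I \<tau> M A E \<longleftrightarrow>
     E \<in> M \<rightarrow> A \<and> op_linear_on I M E \<and>
     (\<forall>x\<in>M. op_positive I x \<longrightarrow> op_positive I (E x)) \<and>
     (\<forall>a\<in>A. E a = a) \<and>
     (\<forall>a\<in>A. \<forall>b\<in>A. \<forall>x\<in>M. E (op_mult I (op_mult I a x) b) = op_mult I (op_mult I a (E x)) b) \<and>
     (\<forall>x\<in>M. \<tau> (E x) = \<tau> x)"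

text \<open>
  On \<open>M\<close> the trace-preserving conditional expectation is unique, because \<open>\<tau>\<close> is faithful; the
  choice operator only leaves the irrelevant values outside \<open>M\<close> unspecified.
\<close>

definition cond_exp ::
  "'i set \<Rightarrow> ('i op \<Rightarrow> complex) \<Rightarrow> 'i op set \<Rightarrow> 'i op set \<Rightarrow> 'i op \<Rightarrow> 'i op" where
  "cond_exp I \<tau> M A = (SOME E. conditional_expectation I \<tau> M A E)"

text \<open>$\|E_A(uxu^*y) - E_A(x)E_A(y)\|_2$\<close>

definition mixing_defect ::
  "'i set \<Rightarrow> ('i op \<Rightarrow> complex) \<Rightarrow> 'i op set \<Rightarrow> 'i op set \<Rightarrow> 'i op \<Rightarrow> 'i op \<Rightarrow> 'i op \<Rightarrow> real" where
  "mixing_defect I \<tau> M A u x y = norm2 I \<tau>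
     (op_diff I
       (cond_exp I \<tau> M A (op_mult I (op_mult I (op_mult I u x) (op_adj I u)) y))
       (op_mult I (cond_exp I \<tau> M A x) (cond_exp I \<tau> M A y)))"

definition strongly_mixing_action ::
  "'i set \<Rightarrow> ('i op \<Rightarrow> complex) \<Rightarrow> 'i op set \<Rightarrow> 'i op set \<Rightarrow> 'i op set \<Rightarrow> bool" where
  "strongly_mixing_action I \<tau> M A G \<longleftrightarrow>
     (\<forall>x\<in>M. \<forall>y\<in>M. \<forall>\<epsilon>>0. \<exists>F. finite F \<and> F \<subseteq> G \<and>
        (\<forall>u\<in>G - F. mixing_defect I \<tau> M A u x y < \<epsilon>))"

definition strongly_mixing ::
  "'i set \<Rightarrow> ('i op \<Rightarrow> complex) \<Rightarrow> 'i op set \<Rightarrow> 'i op set \<Rightarrow> bool" where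
  "strongly_mixing I \<tau> M A \<longleftrightarrow>
     (\<forall>G. subgroup G (unitary_group I A) \<and> almost_orthonormal I A G \<longrightarrow>
        strongly_mixing_action I \<tau> M A G)"


section \<open>Group von Neumann algebras\<close>

definition left_regular :: "('g, 'b) monoid_scheme \<Rightarrow> 'g \<Rightarrow> 'g op" where
  "left_regular G g =
     (\<lambda>\<xi>\<in>l2 (carrier G). \<lambda>h. if h \<in> carrier G then \<xi> (inv\<^bsub>G\<^esub> g \<otimes>\<^bsub>G\<^esub> h) else 0)"

text \<open>
  For a subgroup \<open>H\<close> of \<open>G\<close> this is the algebra $L(H)$ in its identification with a subalgebra of
  $L(G)$, acting on $\ell^2(G)$; $L(G)$ itself is the case \<open>H = carrier G\<close>.
\<close>

definition group_vna :: "('g, 'b) monoid_scheme \<Rightarrow> 'g set \<Rightarrow> 'g op set" where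
  "group_vna G H = generated_vna (carrier G) (left_regular G ` H)"

definition group_trace :: "('g, 'b) monoid_scheme \<Rightarrow> 'g op \<Rightarrow> complex" where
  "group_trace G x = l2_inner (carrier G) (x (delta \<one>\<^bsub>G\<^esub>)) (delta \<one>\<^bsub>G\<^esub>)"

end

theory Submission
  imports Defs "HOL-Algebra.Coset"
begin

text \<open>
  Everything is computed on the vectors $\hat x = x\delta_1$. An operator in $L(\Gamma)$ has the
  matrix $\langle x\delta_h,\delta_g\rangle = \hat x(gh^{-1})$, it lies in $L(\Gamma_0)$ exactly when
  $\hat x$ vanishes off $\Gamma_0$, its trace norm $\|x\|_2$ is $\|\hat x\|$, and $E_A$ acts on $\hat x$ by
  restriction to $\Gamma_0$ (\<open>group_vnaI\<close>, \<open>group_vna_entry\<close>, \<open>group_vna_support\<close>,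
  \<open>norm2_group_trace\<close>, \<open>cond_exp_delta\<close>). The first two facts are matrix computations,
  because the von Neumann algebra generated by a self-adjoint set is its bicommutant.

  The substantial implication is (2) to (3). Put $z = x - E_A(x)$. As \<open>A\<close> is abelian and \<open>u\<close> is unitary,
  the defect equals $\|P z u^* P^{\perp}\hat y\|$, where \<open>P\<close> is the projection onto $\ell^2(\Gamma_0)$
  (\<open>mixing_defect_off_diagonal\<close>). For fixed \<open>x\<close> this is a seminorm in the vector $P^{\perp}\hat y$, bounded
  uniformly in \<open>u\<close>, so it suffices to treat $\delta_h$ with $h \notin \Gamma_0$
  (\<open>l2_seminorms_tendsto_zero\<close>). There transposition turns $\|P z u^*\delta_h\|$ into the norm of
  $u\widehat{z^*}$ on the coset $h\Gamma_0$ (\<open>l2_norm_restrict_transpose\<close>). This is again a uniformly bounded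
  seminorm, now in $\widehat{z^*}$, which vanishes on $\Gamma_0$; so it suffices to treat $u\delta_g$ with
  $g \notin \Gamma_0$. On $h\Gamma_0$ that vector has the values $\hat u(hsg^{-1})$ with $s \in \Gamma_0$, and by
  (2) only finitely many of the points $hsg^{-1}$ lie in $\Gamma_0$, where $\hat u$ lives. Finitely many
  matrix coefficients of \<open>u\<close> remain, and each of them tends to zero along an almost orthonormal set
  (\<open>restrict_left_coset_tendsto_zero\<close>). Passing through vectors twice in this way avoids approximating
  operators, whose norms could not be controlled.

  (3) contains (4). The group $\lambda(\Gamma_0)$ is almost orthonormal, because $\lambda_s$ tends ultraweakly
  to zero as \<open>s\<close> leaves the finite subsets of $\Gamma_0$ (\<open>almost_orthonormal_left_regular\<close>); so (4) yields (1).
  For (1) to (2), take $x = \lambda_g$ and $y = \lambda_h$ with \<open>g\<close> and \<open>h\<close> outside $\Gamma_0$: the defect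
  at $u = \lambda_{s^{-1}}$ is 1 or 0 according to whether $gsh$ lies in $\Gamma_0$
  (\<open>malnormal_at_infinity_if_mixing\<close>).
\<close>

section \<open>Square-summable families\<close>

lemma L2_set_le_l2_norm:
  assumes "\<xi> \<in> l2 I" "finite F" "F \<subseteq> I"
  shows "L2_set (\<lambda>i. cmod (\<xi> i)) F \<le> l2_norm I \<xi>"
  unfolding L2_set_def l2_norm_def
  using assms by (intro real_sqrt_le_mono finite_sum_le_infsum) (auto simp: l2_def)

text \<open>
  Membership in $\ell^2$ and a norm bound are both certified by the finite sections. Sums, compressions and
  adjoints below are all controlled through this criterion.
\<close>

lemma l2_of_bounded_L2_sets:
  assumes zero: "\<And>i. i \<notin> I \<Longrightarrow> \<xi> i = 0"
    and bound: "\<And>F. finite F \<Longrightarrow> F \<subseteq> I \<Longrightarrow> L2_set (\<lambda>i. cmod (\<xi> i)) F \<le> c"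
  shows "\<xi> \<in> l2 I" and "l2_norm I \<xi> \<le> c"
proof -
  have c: "0 \<le> c" using bound[of "{}"] by simp
  have le: "(\<Sum>i\<in>F. (cmod (\<xi> i))\<^sup>2) \<le> c\<^sup>2" if "finite F" "F \<subseteq> I" for F
    using bound[OF that] c unfolding L2_set_def by (simp add: sqrt_le_D)
  have s: "(\<lambda>i. (cmod (\<xi> i))\<^sup>2) summable_on I"
    by (rule nonneg_bdd_above_summable_on) (use le in \<open>auto intro!: bdd_aboveI[of _ "c\<^sup>2"]\<close>)
  then show "\<xi> \<in> l2 I" using zero by (simp add: l2_def)
  have "(\<Sum>\<^sub>\<infinity>i\<in>I. (cmod (\<xi> i))\<^sup>2) \<le> c\<^sup>2"
    by (rule infsum_le_finite_sums[OF s le])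
  then show "l2_norm I \<xi> \<le> c"
    unfolding l2_norm_def using c by (metis real_sqrt_le_mono real_sqrt_abs abs_of_nonneg)
qed

lemma l2_norm_nonneg [simp]: "0 \<le> l2_norm I \<xi>"
  by (simp add: l2_norm_def infsum_nonneg)

lemma l2_outside: "\<xi> \<in> l2 I \<Longrightarrow> i \<notin> I \<Longrightarrow> \<xi> i = 0"
  by (simp add: l2_def)

lemma cmod_le_l2_norm:
  assumes "\<xi> \<in> l2 I"
  shows "cmod (\<xi> i) \<le> l2_norm I \<xi>"
proof (cases "i \<in> I")
  case True
  then show ?thesis using L2_set_le_l2_norm[OF assms, of "{i}"] by simp
qed (simp add: l2_outside[OF assms])

lemma l2_add:
  assumes "\<xi> \<in> l2 I" "\<eta> \<in> l2 I"
  shows l2_add_closed: "(\<lambda>i. \<xi> i + \<eta> i) \<in> l2 I"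
    and l2_norm_triangle: "l2_norm I (\<lambda>i. \<xi> i + \<eta> i) \<le> l2_norm I \<xi> + l2_norm I \<eta>"
proof -
  have "L2_set (\<lambda>i. cmod (\<xi> i + \<eta> i)) F \<le> l2_norm I \<xi> + l2_norm I \<eta>" if "finite F" "F \<subseteq> I" for F
  proof -
    have "L2_set (\<lambda>i. cmod (\<xi> i + \<eta> i)) F \<le> L2_set (\<lambda>i. cmod (\<xi> i) + cmod (\<eta> i)) F"
      by (intro L2_set_mono norm_triangle_ineq) auto
    also have "\<dots> \<le> L2_set (\<lambda>i. cmod (\<xi> i)) F + L2_set (\<lambda>i. cmod (\<eta> i)) F"
      by (rule L2_set_triangle_ineq)
    also have "\<dots> \<le> l2_norm I \<xi> + l2_norm I \<eta>"
      by (intro add_mono L2_set_le_l2_norm assms that)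
    finally show ?thesis .
  qed
  then show "(\<lambda>i. \<xi> i + \<eta> i) \<in> l2 I" "l2_norm I (\<lambda>i. \<xi> i + \<eta> i) \<le> l2_norm I \<xi> + l2_norm I \<eta>"
    using l2_of_bounded_L2_sets[of I "\<lambda>i. \<xi> i + \<eta> i"] l2_outside[OF assms(1)] l2_outside[OF assms(2)]
    by auto
qed

lemma l2_scale_closed: "\<xi> \<in> l2 I \<Longrightarrow> (\<lambda>i. c * \<xi> i) \<in> l2 I"
  by (auto simp: l2_def norm_mult power_mult_distrib intro!: summable_on_cmult_right)

lemma l2_norm_scale: "l2_norm I (\<lambda>i. c * \<xi> i) = cmod c * l2_norm I \<xi>"
  by (simp add: l2_norm_def norm_mult power_mult_distrib infsum_cmult_right' real_sqrt_mult)

lemma l2_zero [simp]: "(\<lambda>i. 0) \<in> l2 I"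
  by (simp add: l2_def)

lemma l2_norm_zero [simp]: "l2_norm I (\<lambda>i. 0) = 0"
  by (simp add: l2_norm_def)

lemma l2_sum_closed:
  assumes "finite F" "\<And>j. j \<in> F \<Longrightarrow> f j \<in> l2 I"
  shows "(\<lambda>i. \<Sum>j\<in>F. f j i) \<in> l2 I"
  using assms by (induction F rule: finite_induct) (auto intro: l2_add_closed)

lemma delta_l2: "i \<in> I \<Longrightarrow> delta i \<in> l2 I"
proof -
  assume "i \<in> I"
  then have "(\<lambda>j. (cmod (delta i j))\<^sup>2) summable_on I \<longleftrightarrow> (\<lambda>j. (cmod (delta i j))\<^sup>2) summable_on {i}"
    by (intro summable_on_cong_neutral) (auto simp: delta_def)
  with \<open>i \<in> I\<close> show ?thesis by (auto simp: l2_def delta_def)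
qed

lemma l2_norm_delta: "i \<in> I \<Longrightarrow> l2_norm I (delta i) = 1"
proof -
  assume "i \<in> I"
  then have "(\<Sum>\<^sub>\<infinity>j\<in>I. (cmod (delta i j))\<^sup>2) = (\<Sum>\<^sub>\<infinity>j\<in>{i}. (cmod (delta i j))\<^sup>2)"
    by (intro infsum_cong_neutral) (auto simp: delta_def)
  then show ?thesis by (simp add: l2_norm_def delta_def)
qed

lemma l2_inner_abs_summable:
  assumes "\<xi> \<in> l2 I" "\<eta> \<in> l2 I"
  shows "(\<lambda>i. cmod (\<xi> i * cnj (\<eta> i))) summable_on I"
    and cauchy_schwarz_abs: "(\<Sum>\<^sub>\<infinity>i\<in>I. cmod (\<xi> i * cnj (\<eta> i))) \<le> l2_norm I \<xi> * l2_norm I \<eta>"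
proof -
  have le: "(\<Sum>i\<in>F. cmod (\<xi> i * cnj (\<eta> i))) \<le> l2_norm I \<xi> * l2_norm I \<eta>" if "finite F" "F \<subseteq> I" for F
  proof -
    have "(\<Sum>i\<in>F. cmod (\<xi> i * cnj (\<eta> i))) = (\<Sum>i\<in>F. \<bar>cmod (\<xi> i)\<bar> * \<bar>cmod (\<eta> i)\<bar>)"
      by (simp add: norm_mult)
    also have "\<dots> \<le> L2_set (\<lambda>i. cmod (\<xi> i)) F * L2_set (\<lambda>i. cmod (\<eta> i)) F"
      by (rule L2_set_mult_ineq)
    also have "\<dots> \<le> l2_norm I \<xi> * l2_norm I \<eta>"
      by (intro mult_mono L2_set_le_l2_norm assms that) auto
    finally show ?thesis .
  qed
  show s: "(\<lambda>i. cmod (\<xi> i * cnj (\<eta> i))) summable_on I"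
    by (rule nonneg_bdd_above_summable_on) (use le in \<open>auto intro!: bdd_aboveI\<close>)
  show "(\<Sum>\<^sub>\<infinity>i\<in>I. cmod (\<xi> i * cnj (\<eta> i))) \<le> l2_norm I \<xi> * l2_norm I \<eta>"
    by (rule infsum_le_finite_sums[OF s le])
qed

lemma l2_inner_summable:
  "\<xi> \<in> l2 I \<Longrightarrow> \<eta> \<in> l2 I \<Longrightarrow> (\<lambda>i. \<xi> i * cnj (\<eta> i)) summable_on I"
  by (drule (1) l2_inner_abs_summable) (rule abs_summable_summable)

lemma cauchy_schwarz:
  assumes "\<xi> \<in> l2 I" "\<eta> \<in> l2 I"
  shows "cmod (l2_inner I \<xi> \<eta>) \<le> l2_norm I \<xi> * l2_norm I \<eta>"
  unfolding l2_inner_def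
  by (rule order_trans[OF norm_infsum_bound cauchy_schwarz_abs[OF assms]])
    (rule l2_inner_abs_summable[OF assms])

lemma l2_inner_add_left:
  assumes "\<xi> \<in> l2 I" "\<xi>' \<in> l2 I" "\<eta> \<in> l2 I"
  shows "l2_inner I (\<lambda>i. \<xi> i + \<xi>' i) \<eta> = l2_inner I \<xi> \<eta> + l2_inner I \<xi>' \<eta>"
  unfolding l2_inner_def distrib_right by (intro infsum_add l2_inner_summable assms)

lemma l2_inner_scale_left: "l2_inner I (\<lambda>i. c * \<xi> i) \<eta> = c * l2_inner I \<xi> \<eta>"
  unfolding l2_inner_def mult.assoc by (rule infsum_cmult_right')

lemma l2_inner_commute: "l2_inner I \<eta> \<xi> = cnj (l2_inner I \<xi> \<eta>)"
  unfolding l2_inner_def infsum_cnj[symmetric] by (simp add: mult.commute)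

lemma l2_inner_delta: 
  assumes "i \<in> I" 
  shows "l2_inner I \<xi> (delta i) = \<xi> i" and "l2_inner I (delta i) \<xi> = cnj (\<xi> i)"
proof -
  have "l2_inner I \<xi> (delta i) = (\<Sum>\<^sub>\<infinity>j\<in>{i}. \<xi> j * cnj (delta i j))"
    unfolding l2_inner_def using assms by (intro infsum_cong_neutral) (auto simp: delta_def)
  then show *: "l2_inner I \<xi> (delta i) = \<xi> i" by (simp add: delta_def)
  show "l2_inner I (delta i) \<xi> = cnj (\<xi> i)"
    by (subst l2_inner_commute) (simp add: *)
qed

lemma l2_inner_self:
  assumes "\<xi> \<in> l2 I"
  shows "l2_inner I \<xi> \<xi> = complex_of_real ((l2_norm I \<xi>)\<^sup>2)"
proof -
  have "(l2_norm I \<xi>)\<^sup>2 = (\<Sum>\<^sub>\<infinity>i\<in>I. (cmod (\<xi> i))\<^sup>2)"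
    by (simp add: l2_norm_def infsum_nonneg)
  moreover have "l2_inner I \<xi> \<xi> = (\<Sum>\<^sub>\<infinity>i\<in>I. complex_of_real ((cmod (\<xi> i))\<^sup>2))"
    unfolding l2_inner_def by (simp only: complex_norm_square)
  moreover have "(\<Sum>\<^sub>\<infinity>i\<in>I. complex_of_real ((cmod (\<xi> i))\<^sup>2))
      = complex_of_real (\<Sum>\<^sub>\<infinity>i\<in>I. (cmod (\<xi> i))\<^sup>2)"
    by (intro infsumI has_sum_of_real has_sum_infsum) (use assms in \<open>simp add: l2_def\<close>)
  ultimately show ?thesis by simp
qed

definition restrict_vec :: "'i set \<Rightarrow> 'i vec \<Rightarrow> 'i vec" where
  "restrict_vec B \<xi> = (\<lambda>i. if i \<in> B then \<xi> i else 0)"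

lemma restrict_vec_apply: "restrict_vec B \<xi> i = (if i \<in> B then \<xi> i else 0)"
  by (simp add: restrict_vec_def)

lemma restrict_vec:
  assumes "\<xi> \<in> l2 I"
  shows restrict_vec_closed: "restrict_vec B \<xi> \<in> l2 I"
    and l2_norm_restrict_vec_le: "l2_norm I (restrict_vec B \<xi>) \<le> l2_norm I \<xi>"
proof -
  have "L2_set (\<lambda>i. cmod (restrict_vec B \<xi> i)) F \<le> l2_norm I \<xi>" if "finite F" "F \<subseteq> I" for F
    by (rule order_trans[OF L2_set_mono L2_set_le_l2_norm[OF assms that]])
      (auto simp: restrict_vec_def)
  moreover have "restrict_vec B \<xi> i = 0" if "i \<notin> I" for i
    using l2_outside[OF assms that] by (simp add: restrict_vec_def)
  ultimately show "restrict_vec B \<xi> \<in> l2 I" "l2_norm I (restrict_vec B \<xi>) \<le> l2_norm I \<xi>"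
    using l2_of_bounded_L2_sets[of I "restrict_vec B \<xi>" "l2_norm I \<xi>"] by simp_all
qed

lemma l2_tail_small:
  assumes "\<xi> \<in> l2 I" "0 < \<epsilon>"
  obtains F where "finite F" "F \<subseteq> I" "l2_norm I (restrict_vec (- F) \<xi>) \<le> \<epsilon>"
proof -
  let ?f = "\<lambda>i. (cmod (\<xi> i))\<^sup>2"
  have sm: "?f summable_on I" using assms(1) by (simp add: l2_def)
  obtain F where F: "finite F" "F \<subseteq> I" "dist (sum ?f F) (infsum ?f I) \<le> \<epsilon>\<^sup>2"
    using infsum_finite_approximation[OF sm, of "\<epsilon>\<^sup>2"] assms(2) by auto
  have "L2_set (\<lambda>i. cmod (restrict_vec (- F) \<xi> i)) G \<le> \<epsilon>" if G: "finite G" "G \<subseteq> I" for G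
  proof -
    have "(\<Sum>i\<in>G. (cmod (restrict_vec (- F) \<xi> i))\<^sup>2) = sum ?f (G - F)"
      using G(1) by (intro sum.mono_neutral_cong_right) (auto simp: restrict_vec_def)
    moreover have "sum ?f (G - F) + sum ?f F = sum ?f (G \<union> F)"
      using G F by (subst sum.union_disjoint[symmetric]) (auto simp: Un_commute)
    moreover have "sum ?f (G \<union> F) \<le> infsum ?f I"
      using G F by (intro finite_sum_le_infsum sm) auto
    ultimately have "(\<Sum>i\<in>G. (cmod (restrict_vec (- F) \<xi> i))\<^sup>2) \<le> \<epsilon>\<^sup>2"
      using F(3) by (auto simp: dist_real_def)
    then show ?thesis unfolding L2_set_def
      using assms(2) by (metis real_sqrt_le_mono real_sqrt_abs abs_of_nonneg less_imp_le)
  qed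
  then have "l2_norm I (restrict_vec (- F) \<xi>) \<le> \<epsilon>"
    using l2_of_bounded_L2_sets(2)[of I "restrict_vec (- F) \<xi>" \<epsilon>]
      l2_outside[OF restrict_vec_closed[OF assms(1)]] by simp
  with F that show thesis by blast
qed

text \<open>
  The bound \<open>K\<close> is a parameter, since families of seminorms with a common bound are considered.
\<close>

definition l2_seminorm :: "'i set \<Rightarrow> real \<Rightarrow> ('i vec \<Rightarrow> real) \<Rightarrow> bool" where
  "l2_seminorm I K p \<longleftrightarrow>
     (\<forall>\<xi>\<in>l2 I. \<forall>\<eta>\<in>l2 I. p (\<lambda>i. \<xi> i + \<eta> i) \<le> p \<xi> + p \<eta>) \<and>
     (\<forall>c. \<forall>\<xi>\<in>l2 I. p (\<lambda>i. c * \<xi> i) \<le> cmod c * p \<xi>) \<and>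
     (\<forall>\<xi>\<in>l2 I. 0 \<le> p \<xi> \<and> p \<xi> \<le> K * l2_norm I \<xi>)"

lemma l2_seminorm_sum_le:
  assumes p: "l2_seminorm I K p" and "finite F" "F \<subseteq> I"
  shows "p (\<lambda>i. \<Sum>j\<in>F. \<xi> j * delta j i) \<le> (\<Sum>j\<in>F. cmod (\<xi> j) * p (delta j))"
  using assms(2,3)
proof (induction F rule: finite_induct)
  case empty
  have "p (\<lambda>i. 0) \<le> K * l2_norm I (\<lambda>i. 0)"
    using p l2_zero unfolding l2_seminorm_def by blast
  then show ?case by simp
next
  case (insert j F)
  have mem: "(\<lambda>i. \<xi> j * delta j i) \<in> l2 I" "(\<lambda>i. \<Sum>j\<in>F. \<xi> j * delta j i) \<in> l2 I"
    using insert by (auto intro!: l2_sum_closed l2_scale_closed delta_l2)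
  have "p (\<lambda>i. \<Sum>j\<in>insert j F. \<xi> j * delta j i)
      = p (\<lambda>i. \<xi> j * delta j i + (\<Sum>j\<in>F. \<xi> j * delta j i))"
    using insert by simp
  also have "\<dots> \<le> p (\<lambda>i. \<xi> j * delta j i) + p (\<lambda>i. \<Sum>j\<in>F. \<xi> j * delta j i)"
    using p mem by (simp add: l2_seminorm_def)
  also have "\<dots> \<le> cmod (\<xi> j) * p (delta j) + (\<Sum>j\<in>F. cmod (\<xi> j) * p (delta j))"
    using p insert delta_l2[of j I] by (intro add_mono) (auto simp: l2_seminorm_def)
  finally show ?case using insert by simp
qed

text \<open>
  The finitely supported vectors are dense and the common bound \<open>K\<close> makes the tail of \<open>\<xi>\<close> contribute little
  for all indices at once, so convergence on the basis vectors spreads to all vectors supported in \<open>B\<close>. The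
  constant family gives the usual density argument (\<open>l2_seminorm_eq_0\<close>).
\<close>

lemma l2_seminorms_tendsto_zero:
  assumes p: "\<forall>\<^sub>F u in F. l2_seminorm I K (p u)"
    and lim: "\<And>i. i \<in> B \<Longrightarrow> i \<in> I \<Longrightarrow> ((\<lambda>u. p u (delta i)) \<longlongrightarrow> 0) F"
    and \<xi>: "\<xi> \<in> l2 I" "\<And>i. i \<notin> B \<Longrightarrow> \<xi> i = 0"
  shows "((\<lambda>u. p u \<xi>) \<longlongrightarrow> 0) F"
proof (rule tendstoI)
  fix \<epsilon> :: real assume "0 < \<epsilon>"
  \<comment> \<open>The added 1 keeps the denominator positive when the bound is zero.\<close>
  define \<delta> where "\<delta> = \<epsilon> / (2 * (\<bar>K\<bar> + 1))"
  have \<delta>: "0 < \<delta>" "\<bar>K\<bar> * \<delta> < \<epsilon> / 2"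
    using \<open>0 < \<epsilon>\<close> by (auto simp: \<delta>_def field_simps)
  obtain A where A: "finite A" "A \<subseteq> I" "l2_norm I (restrict_vec (- A) \<xi>) \<le> \<delta>"
    using l2_tail_small[OF \<xi>(1) \<delta>(1)] .
  have mem: "(\<lambda>i. \<Sum>j\<in>A. \<xi> j * delta j i) \<in> l2 I" "restrict_vec (- A) \<xi> \<in> l2 I"
    using A \<xi> by (auto intro!: l2_sum_closed l2_scale_closed delta_l2 restrict_vec_closed)
  have split: "\<xi> = (\<lambda>i. (\<Sum>j\<in>A. \<xi> j * delta j i) + restrict_vec (- A) \<xi> i)"
    using A(1) by (auto simp: restrict_vec_def delta_def fun_eq_iff if_distrib cong: if_cong)
  have "((\<lambda>u. \<Sum>j\<in>A. cmod (\<xi> j) * p u (delta j)) \<longlongrightarrow> 0) F"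
  proof (rule tendsto_null_sum)
    fix j assume "j \<in> A"
    with A(2) have "j \<in> I" by blast
    then show "((\<lambda>u. cmod (\<xi> j) * p u (delta j)) \<longlongrightarrow> 0) F"
      using \<xi>(2)[of j] lim[of j] by (cases "j \<in> B") (auto intro!: tendsto_mult_right_zero)
  qed
  then have "\<forall>\<^sub>F u in F. (\<Sum>j\<in>A. cmod (\<xi> j) * p u (delta j)) < \<epsilon> / 2"
    using order_tendstoD(2)[of _ 0 F "\<epsilon> / 2"] \<open>0 < \<epsilon>\<close> by simp
  with p show "\<forall>\<^sub>F u in F. dist (p u \<xi>) 0 < \<epsilon>"
  proof eventually_elim
    case (elim u)
    have "p u \<xi> \<le> p u (\<lambda>i. \<Sum>j\<in>A. \<xi> j * delta j i) + p u (restrict_vec (- A) \<xi>)"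
      using elim(1) mem by (subst split) (simp add: l2_seminorm_def)
    also have "\<dots> \<le> (\<Sum>j\<in>A. cmod (\<xi> j) * p u (delta j)) + K * l2_norm I (restrict_vec (- A) \<xi>)"
      using l2_seminorm_sum_le[OF elim(1) A(1,2)] elim(1) mem(2)
      by (intro add_mono) (auto simp: l2_seminorm_def)
    also have "K * l2_norm I (restrict_vec (- A) \<xi>) \<le> \<bar>K\<bar> * \<delta>"
      using A(3) by (intro mult_mono) auto
    finally have "p u \<xi> < \<epsilon>" using elim(2) \<delta>(2) by linarith
    moreover have "0 \<le> p u \<xi>" using elim(1) \<xi>(1) by (simp add: l2_seminorm_def)
    ultimately show ?case by simp
  qed
qed

corollary l2_seminorm_eq_0:
  assumes "l2_seminorm I K p" "\<And>i. i \<in> I \<Longrightarrow> p (delta i) = 0" "\<xi> \<in> l2 I"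
  shows "p \<xi> = 0"
  using l2_seminorms_tendsto_zero[of I K "\<lambda>_::nat. p" sequentially UNIV \<xi>] assms
  by (simp add: LIMSEQ_const_iff)

section \<open>Bounded operators, adjoints and commutants\<close>

lemma bounded_opsD:
  assumes "T \<in> bounded_ops I"
  shows bounded_op_closed: "\<xi> \<in> l2 I \<Longrightarrow> T \<xi> \<in> l2 I"
    and bounded_op_add: "\<xi> \<in> l2 I \<Longrightarrow> \<eta> \<in> l2 I \<Longrightarrow> T (\<lambda>i. \<xi> i + \<eta> i) = (\<lambda>i. T \<xi> i + T \<eta> i)"
    and bounded_op_scale: "\<xi> \<in> l2 I \<Longrightarrow> T (\<lambda>i. c * \<xi> i) = (\<lambda>i. c * T \<xi> i)"
  using assms by (auto simp: bounded_ops_def)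

lemma bounded_op_bound:
  assumes "T \<in> bounded_ops I"
  obtains K where "0 \<le> K" "\<And>\<xi>. \<xi> \<in> l2 I \<Longrightarrow> l2_norm I (T \<xi>) \<le> K * l2_norm I \<xi>"
proof -
  obtain K where K: "\<forall>\<xi>\<in>l2 I. l2_norm I (T \<xi>) \<le> K * l2_norm I \<xi>"
    using assms by (auto simp: bounded_ops_def)
  have "l2_norm I (T \<xi>) \<le> \<bar>K\<bar> * l2_norm I \<xi>" if "\<xi> \<in> l2 I" for \<xi>
    by (rule order_trans[OF bspec[OF K that]]) (simp add: mult_right_mono)
  with that[of "\<bar>K\<bar>"] show thesis by simp
qed

lemma bounded_opsI:
  assumes "\<And>\<xi>. \<xi> \<in> l2 I \<Longrightarrow> T \<xi> \<in> l2 I"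
    and "\<And>\<xi> \<eta>. \<xi> \<in> l2 I \<Longrightarrow> \<eta> \<in> l2 I \<Longrightarrow> T (\<lambda>i. \<xi> i + \<eta> i) = (\<lambda>i. T \<xi> i + T \<eta> i)"
    and "\<And>c \<xi>. \<xi> \<in> l2 I \<Longrightarrow> T (\<lambda>i. c * \<xi> i) = (\<lambda>i. c * T \<xi> i)"
    and "\<And>\<xi>. \<xi> \<in> l2 I \<Longrightarrow> l2_norm I (T \<xi>) \<le> K * l2_norm I \<xi>"
  shows "(\<lambda>\<xi>\<in>l2 I. T \<xi>) \<in> bounded_ops I"
  using assms unfolding bounded_ops_def
  by (auto simp: l2_add_closed l2_scale_closed intro!: exI[of _ K])

lemma bounded_op_ext:
  assumes "S \<in> bounded_ops I" "T \<in> bounded_ops I" "\<And>\<xi>. \<xi> \<in> l2 I \<Longrightarrow> S \<xi> = T \<xi>"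
  shows "S = T"
  using assms by (auto simp: bounded_ops_def intro!: PiE_ext[of S "l2 I" "\<lambda>_. l2 I" T])

lemma op_mult_apply: "\<xi> \<in> l2 I \<Longrightarrow> op_mult I S T \<xi> = S (T \<xi>)"
  by (simp add: op_mult_def compose_eq)

lemma op_mult_closed:
  assumes "S \<in> bounded_ops I" "T \<in> bounded_ops I"
  shows "op_mult I S T \<in> bounded_ops I"
proof -
  obtain K where K: "0 \<le> K" "\<And>\<xi>. \<xi> \<in> l2 I \<Longrightarrow> l2_norm I (S \<xi>) \<le> K * l2_norm I \<xi>"
    using bounded_op_bound[OF assms(1)] by blast
  obtain L where L: "0 \<le> L" "\<And>\<xi>. \<xi> \<in> l2 I \<Longrightarrow> l2_norm I (T \<xi>) \<le> L * l2_norm I \<xi>"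
    using bounded_op_bound[OF assms(2)] by blast
  have "l2_norm I (S (T \<xi>)) \<le> (K * L) * l2_norm I \<xi>" if "\<xi> \<in> l2 I" for \<xi>
  proof -
    have "l2_norm I (S (T \<xi>)) \<le> K * l2_norm I (T \<xi>)"
      by (intro K bounded_op_closed[OF assms(2)] that)
    also have "\<dots> \<le> K * (L * l2_norm I \<xi>)"
      by (intro mult_left_mono L that K(1))
    finally show ?thesis by (simp add: mult.assoc)
  qed
  then show ?thesis
    unfolding op_mult_def compose_def
    by (intro bounded_opsI[where K = "K * L"])
      (simp_all add: bounded_op_closed[OF assms(1)] bounded_op_closed[OF assms(2)]
        bounded_op_add[OF assms(1)] bounded_op_add[OF assms(2)]
        bounded_op_scale[OF assms(1)] bounded_op_scale[OF assms(2)])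
qed

lemma op_mult_assoc:
  assumes "T \<in> bounded_ops I"
  shows "op_mult I (op_mult I R S) T = op_mult I R (op_mult I S T)"
  unfolding op_mult_def compose_def
  by (rule restrict_ext) (simp add: bounded_op_closed[OF assms])

lemma op_one_closed: "op_one I \<in> bounded_ops I"
  unfolding op_one_def by (rule bounded_opsI[where K = 1]) auto

lemma op_one_apply: "\<xi> \<in> l2 I \<Longrightarrow> op_one I \<xi> = \<xi>"
  by (simp add: op_one_def)

lemma op_mult_one:
  assumes "T \<in> bounded_ops I"
  shows op_mult_one_left: "op_mult I (op_one I) T = T"
    and op_mult_one_right: "op_mult I T (op_one I) = T"
  by (rule bounded_op_ext[of _ I];
      simp add: op_mult_closed op_one_closed assms op_mult_apply op_one_apply bounded_op_closed[OF assms])+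

lemma op_add_closed:
  assumes "S \<in> bounded_ops I" "T \<in> bounded_ops I"
  shows "op_add I S T \<in> bounded_ops I"
proof -
  obtain K where K: "0 \<le> K" "\<And>\<xi>. \<xi> \<in> l2 I \<Longrightarrow> l2_norm I (S \<xi>) \<le> K * l2_norm I \<xi>"
    using bounded_op_bound[OF assms(1)] by blast
  obtain L where L: "0 \<le> L" "\<And>\<xi>. \<xi> \<in> l2 I \<Longrightarrow> l2_norm I (T \<xi>) \<le> L * l2_norm I \<xi>"
    using bounded_op_bound[OF assms(2)] by blast
  have "l2_norm I (\<lambda>i. S \<xi> i + T \<xi> i) \<le> (K + L) * l2_norm I \<xi>" if "\<xi> \<in> l2 I" for \<xi>
    using l2_norm_triangle[OF bounded_op_closed[OF assms(1) that] bounded_op_closed[OF assms(2) that]]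
      K(2)[OF that] L(2)[OF that] by (simp add: distrib_right)
  then show ?thesis
    unfolding op_add_def
    by (intro bounded_opsI[where K = "K + L"])
      (simp_all add: bounded_op_closed[OF assms(1)] bounded_op_closed[OF assms(2)] l2_add_closed
        bounded_op_add[OF assms(1)] bounded_op_add[OF assms(2)]
        bounded_op_scale[OF assms(1)] bounded_op_scale[OF assms(2)] algebra_simps)
qed

lemma op_scale_closed:
  assumes "T \<in> bounded_ops I"
  shows "op_scale I c T \<in> bounded_ops I"
proof -
  obtain K where K: "0 \<le> K" "\<And>\<xi>. \<xi> \<in> l2 I \<Longrightarrow> l2_norm I (T \<xi>) \<le> K * l2_norm I \<xi>"
    using bounded_op_bound[OF assms] by blast
  then show ?thesis
    unfolding op_scale_def
    by (intro bounded_opsI[where K = "cmod c * K"])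
      (simp_all add: bounded_op_closed[OF assms] l2_scale_closed bounded_op_add[OF assms]
        bounded_op_scale[OF assms] l2_norm_scale mult_left_mono mult.assoc distrib_left
        mult.left_commute[of c])
qed

lemma op_diff_eq:
  "T \<in> bounded_ops I \<Longrightarrow> op_diff I S T = op_add I S (op_scale I (-1) T)"
  unfolding op_diff_def op_add_def op_scale_def by (rule restrict_ext) simp

lemma op_diff_closed:
  "S \<in> bounded_ops I \<Longrightarrow> T \<in> bounded_ops I \<Longrightarrow> op_diff I S T \<in> bounded_ops I"
  by (simp add: op_diff_eq op_add_closed op_scale_closed)

lemma op_norm_seminorm:
  assumes "T \<in> bounded_ops I" "\<And>\<xi>. \<xi> \<in> l2 I \<Longrightarrow> l2_norm I (T \<xi>) \<le> K * l2_norm I \<xi>"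
  shows "l2_seminorm I K (\<lambda>\<xi>. l2_norm I (T \<xi>))"
  unfolding l2_seminorm_def
  by (simp add: assms(2) bounded_op_add[OF assms(1)] bounded_op_scale[OF assms(1)] l2_norm_scale
      l2_norm_triangle bounded_op_closed[OF assms(1)])

text \<open>
  The entries of \<open>S \<eta>\<close> have to be $\langle \eta, T\delta_i\rangle$. That they are square summable follows by
  testing \<open>T\<close> on $\sum_{i\in F} (S\eta)_i\,\delta_i$ for finite \<open>F\<close>: if \<open>L\<close> is the norm of \<open>S \<eta>\<close> on \<open>F\<close>, then
  $L^2 \le K L \|\eta\|$. The adjoint relation holds on basis vectors by construction and extends by density.
\<close>

lemma adjoint_exists:
  assumes T: "T \<in> bounded_ops I"
  obtains S where "S \<in> bounded_ops I"
    "\<And>\<xi> \<eta>. \<xi> \<in> l2 I \<Longrightarrow> \<eta> \<in> l2 I \<Longrightarrow> l2_inner I (T \<xi>) \<eta> = l2_inner I \<xi> (S \<eta>)"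
proof -
  obtain K where K: "0 \<le> K" "\<And>\<xi>. \<xi> \<in> l2 I \<Longrightarrow> l2_norm I (T \<xi>) \<le> K * l2_norm I \<xi>"
    using bounded_op_bound[OF T] by blast
  define S where "S = (\<lambda>\<eta> i. if i \<in> I then l2_inner I \<eta> (T (delta i)) else 0)"
  have S_delta: "l2_inner I (T (delta i)) \<eta> = cnj (S \<eta> i)" if "i \<in> I" for i \<eta>
    using that by (subst l2_inner_commute) (simp add: S_def)
  have bound: "L2_set (\<lambda>i. cmod (S \<eta> i)) F \<le> K * l2_norm I \<eta>"
    if \<eta>: "\<eta> \<in> l2 I" and F: "finite F" "F \<subseteq> I" for \<eta> F
  proof -
    let ?L = "L2_set (\<lambda>i. cmod (S \<eta> i)) F"
    let ?\<xi> = "\<lambda>i. \<Sum>j\<in>F. S \<eta> j * delta j i"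
    have mem: "?\<xi> \<in> l2 I"
      using F by (auto intro!: l2_sum_closed l2_scale_closed delta_l2)
    have \<xi>: "(\<Sum>j\<in>F. S \<eta> j * delta j i) = (if i \<in> F then S \<eta> i else 0)" for i
      using F(1) by (simp add: delta_def if_distrib cong: if_cong)
    have "l2_norm I ?\<xi> \<le> ?L"
    proof (rule l2_of_bounded_L2_sets(2))
      fix G assume "finite G" "G \<subseteq> I"
      have "(\<Sum>i\<in>G. (cmod (?\<xi> i))\<^sup>2) = (\<Sum>i\<in>G \<inter> F. (cmod (S \<eta> i))\<^sup>2)"
        unfolding \<xi> using \<open>finite G\<close> by (intro sum.mono_neutral_cong_right) auto
      also have "\<dots> \<le> (\<Sum>i\<in>F. (cmod (S \<eta> i))\<^sup>2)"
        using F(1) by (intro sum_mono2) auto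
      finally show "L2_set (\<lambda>i. cmod (?\<xi> i)) G \<le> ?L"
        unfolding L2_set_def by (rule real_sqrt_le_mono)
    next
      fix i assume "i \<notin> I" then show "?\<xi> i = 0" using F(2) by (auto simp: \<xi>)
    qed
    have T_sum: "l2_inner I (T (\<lambda>i. \<Sum>j\<in>G. S \<eta> j * delta j i)) \<eta> = (\<Sum>j\<in>G. S \<eta> j * cnj (S \<eta> j))"
      if "finite G" "G \<subseteq> I" for G
      using that
    proof (induction G rule: finite_induct)
      case empty
      have "T (\<lambda>i. 0) = (\<lambda>i. 0)" using bounded_op_scale[OF T l2_zero, of 0] by simp
      then show ?case by (simp add: l2_inner_def)
    next
      case (insert j G)
      have m: "(\<lambda>i. S \<eta> j * delta j i) \<in> l2 I" "(\<lambda>i. \<Sum>j\<in>G. S \<eta> j * delta j i) \<in> l2 I"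
        using insert by (auto intro!: l2_sum_closed l2_scale_closed delta_l2)
      have "T (\<lambda>i. \<Sum>j\<in>insert j G. S \<eta> j * delta j i)
          = (\<lambda>i. T (\<lambda>i. S \<eta> j * delta j i) i + T (\<lambda>i. \<Sum>j\<in>G. S \<eta> j * delta j i) i)"
        using bounded_op_add[OF T m] insert by simp
      then have "l2_inner I (T (\<lambda>i. \<Sum>j\<in>insert j G. S \<eta> j * delta j i)) \<eta>
          = l2_inner I (T (\<lambda>i. S \<eta> j * delta j i)) \<eta>
            + l2_inner I (T (\<lambda>i. \<Sum>j\<in>G. S \<eta> j * delta j i)) \<eta>"
        using l2_inner_add_left[OF bounded_op_closed[OF T m(1)] bounded_op_closed[OF T m(2)] \<eta>] by simp
      also have "l2_inner I (T (\<lambda>i. S \<eta> j * delta j i)) \<eta> = S \<eta> j * cnj (S \<eta> j)"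
        using insert bounded_op_scale[OF T delta_l2, of j "S \<eta> j"]
        by (simp add: l2_inner_scale_left S_delta)
      finally show ?case using insert by simp
    qed
    have "?L\<^sup>2 = (\<Sum>j\<in>F. (cmod (S \<eta> j))\<^sup>2)"
      by (simp add: L2_set_def sum_nonneg)
    then have "complex_of_real (?L\<^sup>2) = (\<Sum>j\<in>F. S \<eta> j * cnj (S \<eta> j))"
      by (simp only: of_real_sum complex_norm_square)
    then have "?L\<^sup>2 = cmod (l2_inner I (T ?\<xi>) \<eta>)"
      using T_sum[OF F] by (metis norm_of_real abs_of_nonneg zero_le_power2)
    also have "\<dots> \<le> l2_norm I (T ?\<xi>) * l2_norm I \<eta>"
      by (intro cauchy_schwarz bounded_op_closed[OF T] mem \<eta>)
    also have "\<dots> \<le> (K * ?L) * l2_norm I \<eta>"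
      using order_trans[OF K(2)[OF mem] mult_left_mono[OF \<open>l2_norm I ?\<xi> \<le> ?L\<close> K(1)]]
      by (rule mult_right_mono) simp
    finally have "?L * ?L \<le> ?L * (K * l2_norm I \<eta>)" by (simp add: power2_eq_square mult_ac)
    then show ?thesis
      using K(1) by (cases "?L = 0") (auto simp: order_less_le)
  qed
  have S: "S \<eta> \<in> l2 I" "l2_norm I (S \<eta>) \<le> K * l2_norm I \<eta>" if "\<eta> \<in> l2 I" for \<eta>
    using l2_of_bounded_L2_sets[of I "S \<eta>" "K * l2_norm I \<eta>"] bound[OF that]
    by (simp_all add: S_def)
  have "(\<lambda>\<eta>\<in>l2 I. S \<eta>) \<in> bounded_ops I"
  proof (rule bounded_opsI[where K = K])
    fix \<xi> \<eta> assume "\<xi> \<in> l2 I" "\<eta> \<in> l2 I"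
    then show "S (\<lambda>i. \<xi> i + \<eta> i) = (\<lambda>i. S \<xi> i + S \<eta> i)"
      by (auto simp: S_def fun_eq_iff l2_inner_add_left bounded_op_closed[OF T] delta_l2)
  next
    show "S (\<lambda>i. c * \<xi> i) = (\<lambda>i. c * S \<xi> i)" for c \<xi>
      by (auto simp: S_def fun_eq_iff l2_inner_scale_left)
  qed (use S in auto)
  moreover have "l2_inner I (T \<xi>) \<eta> = l2_inner I \<xi> (S \<eta>)" if \<xi>: "\<xi> \<in> l2 I" and \<eta>: "\<eta> \<in> l2 I" for \<xi> \<eta>
  proof -
    let ?p = "\<lambda>\<xi>. cmod (l2_inner I (T \<xi>) \<eta> - l2_inner I \<xi> (S \<eta>))"
    have "l2_seminorm I (2 * K * l2_norm I \<eta>) ?p"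
      unfolding l2_seminorm_def
    proof (intro conjI ballI allI)
      fix \<xi> \<xi>' assume m: "\<xi> \<in> l2 I" "\<xi>' \<in> l2 I"
      show "?p (\<lambda>i. \<xi> i + \<xi>' i) \<le> ?p \<xi> + ?p \<xi>'"
        by (simp only: bounded_op_add[OF T m] l2_inner_add_left[OF m S(1)[OF \<eta>]] add_diff_add
            l2_inner_add_left[OF bounded_op_closed[OF T m(1)] bounded_op_closed[OF T m(2)] \<eta>]
            norm_triangle_ineq)
    next
      fix c \<xi> assume "\<xi> \<in> l2 I"
      then show "?p (\<lambda>i. c * \<xi> i) \<le> cmod c * ?p \<xi>"
        by (simp add: bounded_op_scale[OF T] l2_inner_scale_left norm_mult flip: right_diff_distrib)
    next
      fix \<xi> assume m: "\<xi> \<in> l2 I"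
      have "?p \<xi> \<le> cmod (l2_inner I (T \<xi>) \<eta>) + cmod (l2_inner I \<xi> (S \<eta>))"
        by (rule norm_triangle_ineq4)
      also have "\<dots> \<le> l2_norm I (T \<xi>) * l2_norm I \<eta> + l2_norm I \<xi> * l2_norm I (S \<eta>)"
        by (intro add_mono cauchy_schwarz bounded_op_closed[OF T] S m \<eta>)
      also have "\<dots> \<le> (K * l2_norm I \<xi>) * l2_norm I \<eta> + l2_norm I \<xi> * (K * l2_norm I \<eta>)"
        by (intro add_mono mult_left_mono mult_right_mono K S m \<eta>) auto
      finally show "?p \<xi> \<le> 2 * K * l2_norm I \<eta> * l2_norm I \<xi>" by (simp add: mult_ac)
    qed simp
    moreover have "?p (delta i) = 0" if "i \<in> I" for i
      using that by (simp add: S_delta l2_inner_delta)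
    ultimately have "?p \<xi> = 0" by (rule l2_seminorm_eq_0) (simp_all add: \<xi>)
    then show ?thesis by simp
  qed
  ultimately show thesis using that[of "\<lambda>\<eta>\<in>l2 I. S \<eta>"] by simp
qed

lemma op_adj_unique:
  assumes S: "S \<in> bounded_ops I"
    and adj: "\<And>\<xi> \<eta>. \<xi> \<in> l2 I \<Longrightarrow> \<eta> \<in> l2 I \<Longrightarrow> l2_inner I (T \<xi>) \<eta> = l2_inner I \<xi> (S \<eta>)"
  shows "op_adj I T = S"
  unfolding op_adj_def
proof (rule the_equality)
  fix S' assume S': "S' \<in> bounded_ops I \<and> (\<forall>\<xi>\<in>l2 I. \<forall>\<eta>\<in>l2 I. l2_inner I (T \<xi>) \<eta> = l2_inner I \<xi> (S' \<eta>))"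
  show "S' = S"
  proof (rule bounded_op_ext[of _ I])
    fix \<eta> assume \<eta>: "\<eta> \<in> l2 I"
    have "S' \<eta> i = S \<eta> i" for i
    proof (cases "i \<in> I")
      case True
      then have "l2_inner I (delta i) (S' \<eta>) = l2_inner I (delta i) (S \<eta>)"
        using S' adj[OF delta_l2[OF True] \<eta>] \<eta> delta_l2 by metis
      then show ?thesis using True by (simp add: l2_inner_delta)
    next
      case False
      then show ?thesis
        using l2_outside bounded_op_closed \<eta> S S' by metis
    qed
    then show "S' \<eta> = S \<eta>" by auto
  qed (use S S' in auto)
qed (use assms in auto)

lemma op_adj:
  assumes "T \<in> bounded_ops I"
  shows op_adj_closed: "op_adj I T \<in> bounded_ops I"
    and op_adj_inner: "\<xi> \<in> l2 I \<Longrightarrow> \<eta> \<in> l2 I \<Longrightarrow> l2_inner I (T \<xi>) \<eta> = l2_inner I \<xi> (op_adj I T \<eta>)"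
proof -
  obtain S where S: "S \<in> bounded_ops I"
    "\<And>\<xi> \<eta>. \<xi> \<in> l2 I \<Longrightarrow> \<eta> \<in> l2 I \<Longrightarrow> l2_inner I (T \<xi>) \<eta> = l2_inner I \<xi> (S \<eta>)"
    using adjoint_exists[OF assms] by blast
  have "op_adj I T = S" by (rule op_adj_unique[OF S])
  with S show "op_adj I T \<in> bounded_ops I"
    "\<xi> \<in> l2 I \<Longrightarrow> \<eta> \<in> l2 I \<Longrightarrow> l2_inner I (T \<xi>) \<eta> = l2_inner I \<xi> (op_adj I T \<eta>)" by auto
qed

lemma op_adj_inner':
  assumes "T \<in> bounded_ops I" "\<xi> \<in> l2 I" "\<eta> \<in> l2 I"
  shows "l2_inner I (op_adj I T \<xi>) \<eta> = l2_inner I \<xi> (T \<eta>)"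
  using op_adj_inner[OF assms(1,3,2)] by (metis l2_inner_commute)

lemma op_adj_adj: "T \<in> bounded_ops I \<Longrightarrow> op_adj I (op_adj I T) = T"
  by (rule op_adj_unique) (auto simp: op_adj_inner')

lemma op_adj_mult:
  assumes "S \<in> bounded_ops I" "T \<in> bounded_ops I"
  shows "op_adj I (op_mult I S T) = op_mult I (op_adj I T) (op_adj I S)"
  by (rule op_adj_unique)
    (simp_all add: op_mult_closed op_adj_closed assms op_mult_apply op_adj_inner bounded_op_closed[of _ I])

lemma op_adj_delta:
  assumes "T \<in> bounded_ops I" "i \<in> I" "k \<in> I"
  shows "op_adj I T (delta i) k = cnj (T (delta k) i)"
  using op_adj_inner'[OF assms(1) delta_l2[OF assms(2)] delta_l2[OF assms(3)]] assms(2,3)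
  by (simp add: l2_inner_delta)

lemma bounded_op_eq_infsum:
  assumes "T \<in> bounded_ops I" "\<xi> \<in> l2 I" "i \<in> I"
  shows "T \<xi> i = (\<Sum>\<^sub>\<infinity>k\<in>I. T (delta k) i * \<xi> k)"
proof -
  have "T \<xi> i = l2_inner I \<xi> (op_adj I T (delta i))"
    using op_adj_inner[OF assms(1,2) delta_l2[OF assms(3)]] assms(3) by (simp add: l2_inner_delta)
  also have "\<dots> = (\<Sum>\<^sub>\<infinity>k\<in>I. T (delta k) i * \<xi> k)"
    unfolding l2_inner_def by (rule infsum_cong) (simp add: op_adj_delta assms)
  finally show ?thesis .
qed

lemma bounded_op_eqI_delta:
  assumes "S \<in> bounded_ops I" "T \<in> bounded_ops I"
    and "\<And>i k. i \<in> I \<Longrightarrow> k \<in> I \<Longrightarrow> S (delta k) i = T (delta k) i"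
  shows "S = T"
proof (rule bounded_op_ext[OF assms(1,2)])
  fix \<xi> assume \<xi>: "\<xi> \<in> l2 I"
  have "S \<xi> i = T \<xi> i" for i
  proof (cases "i \<in> I")
    case True
    then show ?thesis
      unfolding bounded_op_eq_infsum[OF assms(1) \<xi> True] bounded_op_eq_infsum[OF assms(2) \<xi> True]
      by (intro infsum_cong) (simp add: assms(3))
  next
    case False
    then show ?thesis using l2_outside bounded_op_closed assms(1,2) \<xi> by metis
  qed
  then show "S \<xi> = T \<xi>" by auto
qed

lemma commutant_bounded: "commutant I X \<subseteq> bounded_ops I"
  by (auto simp: commutant_def)

lemma commutant_apply:
  assumes "T \<in> commutant I X" "S \<in> X" "\<xi> \<in> l2 I"
  shows "S (T \<xi>) = T (S \<xi>)"
proof -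
  have "op_mult I S T = op_mult I T S" using assms by (simp add: commutant_def)
  then show ?thesis using assms(3) by (metis op_mult_apply)
qed

lemma commutantI:
  assumes "T \<in> bounded_ops I" "X \<subseteq> bounded_ops I"
    and "\<And>S \<xi>. S \<in> X \<Longrightarrow> \<xi> \<in> l2 I \<Longrightarrow> S (T \<xi>) = T (S \<xi>)"
  shows "T \<in> commutant I X"
  unfolding commutant_def
  using assms by (auto intro!: bounded_op_ext[of _ I] op_mult_closed simp: op_mult_apply)

lemma commutant_antimono: "X \<subseteq> Y \<Longrightarrow> commutant I Y \<subseteq> commutant I X"
  by (auto simp: commutant_def)

lemma subset_bicommutant: "X \<subseteq> bounded_ops I \<Longrightarrow> X \<subseteq> commutant I (commutant I X)"
  by (auto simp: commutant_def)

lemma commutant_adj_closed: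
  assumes X: "X \<subseteq> bounded_ops I" "\<And>S. S \<in> X \<Longrightarrow> op_adj I S \<in> X" and T: "T \<in> commutant I X"
  shows "op_adj I T \<in> commutant I X"
  unfolding commutant_def
proof (intro CollectI conjI ballI)
  have Tb: "T \<in> bounded_ops I" using T by (simp add: commutant_def)
  then show "op_adj I T \<in> bounded_ops I" by (rule op_adj_closed)
  fix S assume S: "S \<in> X"
  then have Sb: "S \<in> bounded_ops I" using X(1) by blast
  have "op_mult I (op_adj I S) T = op_mult I T (op_adj I S)"
    using T X(2)[OF S] by (simp add: commutant_def)
  then have "op_adj I (op_mult I (op_adj I S) T) = op_adj I (op_mult I T (op_adj I S))" by simp
  then show "op_mult I S (op_adj I T) = op_mult I (op_adj I T) S"
    by (simp add: op_adj_mult op_adj_closed Sb Tb op_adj_adj)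
qed

text \<open>
  The bicommutant is itself a von Neumann algebra, since every commutant equals its bicommutant; and any von
  Neumann algebra \<open>N\<close> containing \<open>X\<close> contains the bicommutant of \<open>X\<close> because it is the bicommutant of itself.
\<close>

theorem generated_vna_eq_bicommutant:
  assumes X: "X \<subseteq> bounded_ops I" "\<And>S. S \<in> X \<Longrightarrow> op_adj I S \<in> X"
  shows "generated_vna I X = commutant I (commutant I X)"
proof
  have "commutant I (commutant I (commutant I X)) = commutant I X"
    using commutant_antimono[OF subset_bicommutant[OF X(1)]] 
      subset_bicommutant[OF commutant_bounded, of I X] by blast
  then have "von_neumann_algebra I (commutant I (commutant I X))"
    unfolding von_neumann_algebra_def
    using commutant_bounded commutant_adj_closed[OF commutant_bounded commutant_adj_closed[OF X]]
    by simp
  then show "generated_vna I X \<subseteq> commutant I (commutant I X)"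
    using subset_bicommutant[OF X(1)] by (auto simp: generated_vna_def)
  show "commutant I (commutant I X) \<subseteq> generated_vna I X"
    unfolding generated_vna_def
  proof (rule Inter_greatest, clarify)
    fix N T assume N: "von_neumann_algebra I N" "X \<subseteq> N" and T: "T \<in> commutant I (commutant I X)"
    then have "T \<in> commutant I (commutant I N)"
      using commutant_antimono[OF commutant_antimono[OF N(2)]] by blast
    then show "T \<in> N" using N(1) by (simp add: von_neumann_algebra_def)
  qed
qed

lemma commutant_closed:
  assumes X: "X \<subseteq> bounded_ops I"
  shows commutant_one: "op_one I \<in> commutant I X"
    and commutant_mult: "S \<in> commutant I X \<Longrightarrow> T \<in> commutant I X \<Longrightarrow> op_mult I S T \<in> commutant I X"
    and commutant_add: "S \<in> commutant I X \<Longrightarrow> T \<in> commutant I X \<Longrightarrow> op_add I S T \<in> commutant I X"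
    and commutant_scale: "T \<in> commutant I X \<Longrightarrow> op_scale I c T \<in> commutant I X"
proof -
  note cl = bounded_op_closed[OF subsetD[OF X]]
  show "op_one I \<in> commutant I X"
    by (rule commutantI[OF op_one_closed X]) (simp add: op_one_apply cl)
  show "op_scale I c T \<in> commutant I X" if T: "T \<in> commutant I X"
  proof -
    have Tb: "T \<in> bounded_ops I" using T by (simp add: commutant_def)
    show ?thesis
      by (rule commutantI[OF op_scale_closed[OF Tb] X])
       (simp add: op_scale_def cl bounded_op_scale[OF subsetD[OF X]] bounded_op_closed[OF Tb] commutant_apply[OF T])
  qed
  assume S: "S \<in> commutant I X" and T: "T \<in> commutant I X"
  then have b: "S \<in> bounded_ops I" "T \<in> bounded_ops I" by (auto simp: commutant_def)
  show "op_mult I S T \<in> commutant I X"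
    by (rule commutantI[OF op_mult_closed[OF b] X])
      (simp add: op_mult_apply cl bounded_op_closed[OF b(2)] commutant_apply[OF T] commutant_apply[OF S])
  show "op_add I S T \<in> commutant I X"
    by (rule commutantI[OF op_add_closed[OF b] X])
      (simp add: op_add_def cl bounded_op_add[OF subsetD[OF X]] bounded_op_closed[OF b(1)]
        bounded_op_closed[OF b(2)] commutant_apply[OF T] commutant_apply[OF S])
qed

section \<open>Permutation operators, coordinate projections and block diagonals\<close>

definition reindex_op :: "'i set \<Rightarrow> ('i \<Rightarrow> 'i) \<Rightarrow> 'i op" where
  "reindex_op I \<pi> = (\<lambda>\<xi>\<in>l2 I. \<lambda>i. if i \<in> I then \<xi> (\<pi> i) else 0)"

lemma reindex_op:
  assumes \<pi>: "bij_betw \<pi> I I"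
  shows reindex_op_closed: "reindex_op I \<pi> \<in> bounded_ops I"
    and l2_norm_reindex_op: "\<xi> \<in> l2 I \<Longrightarrow> l2_norm I (reindex_op I \<pi> \<xi>) = l2_norm I \<xi>"
proof -
  let ?T = "\<lambda>\<xi> i. if i \<in> I then \<xi> (\<pi> i) else (0::complex)"
  have T: "?T \<xi> \<in> l2 I" "l2_norm I (?T \<xi>) = l2_norm I \<xi>" if "\<xi> \<in> l2 I" for \<xi>
  proof -
    have "(\<lambda>i. (cmod (?T \<xi> i))\<^sup>2) summable_on I \<longleftrightarrow> (\<lambda>i. (cmod (\<xi> (\<pi> i)))\<^sup>2) summable_on I"
      by (intro summable_on_cong) simp
    also have "\<dots> \<longleftrightarrow> (\<lambda>i. (cmod (\<xi> i))\<^sup>2) summable_on I"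
      by (rule summable_on_reindex_bij_betw[OF \<pi>])
    finally show "?T \<xi> \<in> l2 I" using that by (simp add: l2_def)
    have "(\<Sum>\<^sub>\<infinity>i\<in>I. (cmod (?T \<xi> i))\<^sup>2) = (\<Sum>\<^sub>\<infinity>i\<in>I. (cmod (\<xi> (\<pi> i)))\<^sup>2)"
      by (intro infsum_cong) simp
    also have "\<dots> = (\<Sum>\<^sub>\<infinity>i\<in>I. (cmod (\<xi> i))\<^sup>2)"
      by (rule infsum_reindex_bij_betw[OF \<pi>])
    finally show "l2_norm I (?T \<xi>) = l2_norm I \<xi>" by (simp add: l2_norm_def)
  qed
  then show "reindex_op I \<pi> \<in> bounded_ops I"
    unfolding reindex_op_def by (intro bounded_opsI[where K = 1]) (auto simp: fun_eq_iff)
  show "\<xi> \<in> l2 I \<Longrightarrow> l2_norm I (reindex_op I \<pi> \<xi>) = l2_norm I \<xi>"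
    using T(2) by (simp add: reindex_op_def)
qed

lemma op_adj_reindex_op:
  assumes "\<And>i. i \<in> I \<Longrightarrow> \<pi> i \<in> I \<and> \<sigma> (\<pi> i) = i" "\<And>i. i \<in> I \<Longrightarrow> \<sigma> i \<in> I \<and> \<pi> (\<sigma> i) = i"
  shows "op_adj I (reindex_op I \<pi>) = reindex_op I \<sigma>"
proof (rule op_adj_unique)
  have \<sigma>: "bij_betw \<sigma> I I"
    using assms by (intro bij_betw_byWitness[where f' = \<pi>]) auto
  then show "reindex_op I \<sigma> \<in> bounded_ops I" by (rule reindex_op_closed)
  fix \<xi> \<eta> assume "\<xi> \<in> l2 I" "\<eta> \<in> l2 I"
  have "(\<Sum>\<^sub>\<infinity>i\<in>I. \<xi> (\<pi> i) * cnj (\<eta> i)) = (\<Sum>\<^sub>\<infinity>i\<in>I. \<xi> (\<pi> (\<sigma> i)) * cnj (\<eta> (\<sigma> i)))"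
    by (rule infsum_reindex_bij_betw[OF \<sigma>, symmetric])
  also have "\<dots> = (\<Sum>\<^sub>\<infinity>i\<in>I. \<xi> i * cnj (\<eta> (\<sigma> i)))"
    by (intro infsum_cong) (simp add: assms)
  finally show "l2_inner I (reindex_op I \<pi> \<xi>) \<eta> = l2_inner I \<xi> (reindex_op I \<sigma> \<eta>)"
    using \<open>\<xi> \<in> l2 I\<close> \<open>\<eta> \<in> l2 I\<close> by (simp add: l2_inner_def reindex_op_def cong: infsum_cong)
qed

definition coord_proj :: "'i set \<Rightarrow> 'i set \<Rightarrow> 'i op" where
  "coord_proj I B = (\<lambda>\<xi>\<in>l2 I. restrict_vec B \<xi>)"

lemma restrict_vec_linear:
  "restrict_vec B (\<lambda>i. \<xi> i + \<eta> i) = (\<lambda>i. restrict_vec B \<xi> i + restrict_vec B \<eta> i)"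
  "restrict_vec B (\<lambda>i. c * \<xi> i) = (\<lambda>i. c * restrict_vec B \<xi> i)"
  by (auto simp: restrict_vec_def)

lemma coord_proj_closed: "coord_proj I B \<in> bounded_ops I"
  unfolding coord_proj_def
  by (rule bounded_opsI[where K = 1])
    (simp_all add: restrict_vec_closed restrict_vec_linear l2_norm_restrict_vec_le)

lemma coord_proj_apply: "\<xi> \<in> l2 I \<Longrightarrow> coord_proj I B \<xi> = restrict_vec B \<xi>"
  by (simp add: coord_proj_def)

lemma l2_norm_restrict_vec:
  "(l2_norm I (restrict_vec B \<xi>))\<^sup>2 = (\<Sum>\<^sub>\<infinity>i\<in>I \<inter> B. (cmod (\<xi> i))\<^sup>2)"
proof -
  have "(\<Sum>\<^sub>\<infinity>i\<in>I. (cmod (restrict_vec B \<xi> i))\<^sup>2) = (\<Sum>\<^sub>\<infinity>i\<in>I \<inter> B. (cmod (\<xi> i))\<^sup>2)"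
    by (intro infsum_cong_neutral) (auto simp: restrict_vec_def)
  then show ?thesis by (simp add: l2_norm_def infsum_nonneg)
qed

text \<open>
  The block diagonal part of \<open>T\<close> for the partition of \<open>I\<close> into the fibres of \<open>q\<close>. With the cosets of a subgroup
  as blocks it will be the conditional expectation.
\<close>

definition pinching :: "'i set \<Rightarrow> ('i \<Rightarrow> 'c) \<Rightarrow> 'i op \<Rightarrow> 'i op" where
  "pinching I q T = (\<lambda>\<xi>\<in>l2 I. \<lambda>i. if i \<in> I then T (restrict_vec {j. q j = q i} \<xi>) i else 0)"

lemma sum_blocks_le_l2_norm:
  assumes "\<xi> \<in> l2 I" "finite C"
  shows "(\<Sum>c\<in>C. (l2_norm I (restrict_vec {j. q j = c} \<xi>))\<^sup>2) \<le> (l2_norm I \<xi>)\<^sup>2"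
proof -
  let ?f = "\<lambda>i. (cmod (\<xi> i))\<^sup>2"
  have sm: "?f summable_on B" if "B \<subseteq> I" for B
    using assms(1) that by (auto simp: l2_def intro: summable_on_subset_banach)
  have "(\<Sum>c\<in>C. (l2_norm I (restrict_vec {j. q j = c} \<xi>))\<^sup>2) = (\<Sum>c\<in>C. infsum ?f (I \<inter> {j. q j = c}))"
    by (simp add: l2_norm_restrict_vec)
  also have "\<dots> = infsum ?f (\<Union>c\<in>C. I \<inter> {j. q j = c})"
    by (intro sum_infsum assms(2) sm) auto
  also have "\<dots> \<le> infsum ?f I"
    by (intro infsum_mono2 sm) auto
  also have "\<dots> = (l2_norm I \<xi>)\<^sup>2"
    by (simp add: l2_norm_def infsum_nonneg)
  finally show ?thesis .
qed

text \<open>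
  On each block the image is bounded by the norm of \<open>T\<close> times that of the corresponding piece of \<open>\<xi>\<close>, and the
  pieces are orthogonal.
\<close>

lemma pinching_closed:
  assumes T: "T \<in> bounded_ops I"
  shows "pinching I q T \<in> bounded_ops I"
proof -
  obtain K where K: "0 \<le> K" "\<And>\<xi>. \<xi> \<in> l2 I \<Longrightarrow> l2_norm I (T \<xi>) \<le> K * l2_norm I \<xi>"
    using bounded_op_bound[OF T] by blast
  define P where "P = (\<lambda>\<xi> i. if i \<in> I then T (restrict_vec {j. q j = q i} \<xi>) i else 0)"
  have bound: "L2_set (\<lambda>i. cmod (P \<xi> i)) F \<le> K * l2_norm I \<xi>"
    if \<xi>: "\<xi> \<in> l2 I" and F: "finite F" "F \<subseteq> I" for \<xi> F
  proof -
    let ?r = "\<lambda>c. restrict_vec {j. q j = c} \<xi>"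
    have r: "?r c \<in> l2 I" for c by (rule restrict_vec_closed[OF \<xi>])
    have block: "(\<Sum>i\<in>{i \<in> F. q i = c}. (cmod (P \<xi> i))\<^sup>2) \<le> K\<^sup>2 * (l2_norm I (?r c))\<^sup>2" for c
    proof -
      have "(\<Sum>i\<in>{i \<in> F. q i = c}. (cmod (P \<xi> i))\<^sup>2) = (\<Sum>i\<in>{i \<in> F. q i = c}. (cmod (T (?r c) i))\<^sup>2)"
        using F by (intro sum.cong) (auto simp: P_def)
      also have "\<dots> = (L2_set (\<lambda>i. cmod (T (?r c) i)) {i \<in> F. q i = c})\<^sup>2"
        by (simp add: L2_set_def sum_nonneg)
      also have "\<dots> \<le> (l2_norm I (T (?r c)))\<^sup>2"
        using F by (intro power_mono L2_set_le_l2_norm bounded_op_closed[OF T] r) auto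
      also have "\<dots> \<le> (K * l2_norm I (?r c))\<^sup>2"
        by (intro power_mono K r) simp
      finally show ?thesis by (simp add: power_mult_distrib)
    qed
    have "(\<Sum>i\<in>F. (cmod (P \<xi> i))\<^sup>2) = (\<Sum>c\<in>q ` F. \<Sum>i\<in>{i \<in> F. q i = c}. (cmod (P \<xi> i))\<^sup>2)"
      by (rule sum.image_gen[OF F(1)])
    also have "\<dots> \<le> (\<Sum>c\<in>q ` F. K\<^sup>2 * (l2_norm I (?r c))\<^sup>2)"
      by (rule sum_mono) (rule block)
    also have "\<dots> \<le> K\<^sup>2 * (l2_norm I \<xi>)\<^sup>2"
      unfolding sum_distrib_left[symmetric]
      using F(1) by (intro mult_left_mono sum_blocks_le_l2_norm \<xi>) auto
    finally have "(\<Sum>i\<in>F. (cmod (P \<xi> i))\<^sup>2) \<le> (K * l2_norm I \<xi>)\<^sup>2" by (simp add: power_mult_distrib)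
    then show ?thesis
      unfolding L2_set_def using K(1) by (intro real_le_lsqrt) (auto simp: sum_nonneg)
  qed
  have P: "P \<xi> \<in> l2 I" "l2_norm I (P \<xi>) \<le> K * l2_norm I \<xi>" if "\<xi> \<in> l2 I" for \<xi>
    using l2_of_bounded_L2_sets[of I "P \<xi>" "K * l2_norm I \<xi>"] bound[OF that]
    by (simp_all add: P_def)
  have "(\<lambda>\<xi>\<in>l2 I. P \<xi>) \<in> bounded_ops I"
  proof (rule bounded_opsI[where K = K])
    fix \<xi> \<eta> assume "\<xi> \<in> l2 I" "\<eta> \<in> l2 I"
    then show "P (\<lambda>i. \<xi> i + \<eta> i) = (\<lambda>i. P \<xi> i + P \<eta> i)"
      by (auto simp: P_def fun_eq_iff restrict_vec_linear bounded_op_add[OF T] restrict_vec_closed)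
  next
    fix c \<xi> assume "\<xi> \<in> l2 I"
    then show "P (\<lambda>i. c * \<xi> i) = (\<lambda>i. c * P \<xi> i)"
      by (auto simp: P_def fun_eq_iff restrict_vec_linear bounded_op_scale[OF T] restrict_vec_closed)
  qed (use P in auto)
  then show ?thesis by (simp add: pinching_def P_def)
qed

lemma pinching_delta:
  assumes "T \<in> bounded_ops I" "i \<in> I" "k \<in> I"
  shows "pinching I q T (delta k) i = (if q i = q k then T (delta k) i else 0)"
proof -
  have "restrict_vec {j. q j = q i} (delta k) = (if q i = q k then delta k else (\<lambda>i. 0))"
    by (auto simp: restrict_vec_def delta_def)
  moreover have "T (\<lambda>i. 0) = (\<lambda>i. 0)" using bounded_op_scale[OF assms(1) l2_zero, of 0] by simp
  ultimately show ?thesis using assms delta_l2[OF assms(3)] by (simp add: pinching_def)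
qed

lemma restrict_vec_pinching:
  assumes "T \<in> bounded_ops I" "\<xi> \<in> l2 I"
  shows "restrict_vec {j. q j = c} (pinching I q T \<xi>)
    = restrict_vec {j. q j = c} (T (restrict_vec {j. q j = c} \<xi>))"
proof
  fix i
  show "restrict_vec {j. q j = c} (pinching I q T \<xi>) i
    = restrict_vec {j. q j = c} (T (restrict_vec {j. q j = c} \<xi>)) i"
    using l2_outside[OF bounded_op_closed[OF assms(1) restrict_vec_closed[OF assms(2)]], of i]
    by (cases "q i = c") (simp_all add: pinching_def assms(2) restrict_vec_apply)
qed

text \<open>
  The quadratic form of the block diagonal part at \<open>\<xi>\<close> is the sum over the blocks of the quadratic form of \<open>T\<close> at
  the pieces of \<open>\<xi>\<close>.
\<close>

lemma pinching_positive:
  assumes T: "T \<in> bounded_ops I" and pos: "op_positive I T"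
  shows "op_positive I (pinching I q T)"
  unfolding op_positive_def
proof
  fix \<xi> assume \<xi>: "\<xi> \<in> l2 I"
  let ?r = "\<lambda>c. restrict_vec {j. q j = c} \<xi>"
  let ?f = "\<lambda>i. pinching I q T \<xi> i * cnj (\<xi> i)"
  let ?B = "\<lambda>c. {i \<in> I. q i = c}"
  \<comment> \<open>Summation over the index set is regrouped as summation over pairs of a block and a point in it.\<close>
  have bij: "bij_betw snd (Sigma (q ` I) ?B) I"
    by (rule bij_betw_byWitness[where f' = "\<lambda>i. (q i, i)"]) auto
  have sm: "?f summable_on I"
    by (intro l2_inner_summable bounded_op_closed[OF pinching_closed[OF T]] \<xi>)
  then have sm': "(\<lambda>z. ?f (snd z)) summable_on (Sigma (q ` I) ?B)"
    using summable_on_reindex_bij_betw[OF bij, of ?f] by simp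
  have block: "(\<Sum>\<^sub>\<infinity>i\<in>?B c. ?f i) = l2_inner I (T (?r c)) (?r c)" for c
    unfolding l2_inner_def using \<xi>
    by (intro infsum_cong_neutral) (auto simp: restrict_vec_def pinching_def)
  have nonneg: "0 \<le> (\<Sum>\<^sub>\<infinity>i\<in>?B c. ?f i)" for c
    unfolding block using pos restrict_vec_closed[OF \<xi>, of "{j. q j = c}"]
    by (auto simp: op_positive_def complex_nonneg_Reals_iff less_eq_complex_def)
  have sm_c: "(\<lambda>c. \<Sum>\<^sub>\<infinity>i\<in>?B c. ?f i) summable_on (q ` I)"
    using summable_on_Sigma_banach[of "\<lambda>c i. ?f i" "q ` I" ?B] sm' by (simp add: case_prod_unfold)
  have "l2_inner I (pinching I q T \<xi>) \<xi> = infsum ?f I"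
    by (simp add: l2_inner_def)
  also have "\<dots> = (\<Sum>\<^sub>\<infinity>z\<in>Sigma (q ` I) ?B. ?f (snd z))"
    by (rule infsum_reindex_bij_betw[OF bij, symmetric])
  also have "\<dots> = (\<Sum>\<^sub>\<infinity>c\<in>q ` I. \<Sum>\<^sub>\<infinity>i\<in>?B c. ?f i)"
    using infsum_Sigma_banach[OF sm'] by simp
  also have "\<dots> \<ge> 0"
    by (rule infsum_nonneg_complex[OF sm_c nonneg])
  finally show "l2_inner I (pinching I q T \<xi>) \<xi> \<in> \<real>\<^sub>\<ge>\<^sub>0"
    by (auto simp: complex_nonneg_Reals_iff less_eq_complex_def)
qed

lemma pinching_bimodule:
  assumes A: "A \<in> bounded_ops I" "\<And>c \<xi>. \<xi> \<in> l2 I \<Longrightarrow> A (restrict_vec {j. q j = c} \<xi>) = restrict_vec {j. q j = c} (A \<xi>)"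
    and B: "B \<in> bounded_ops I" "\<And>c \<xi>. \<xi> \<in> l2 I \<Longrightarrow> B (restrict_vec {j. q j = c} \<xi>) = restrict_vec {j. q j = c} (B \<xi>)"
    and T: "T \<in> bounded_ops I"
  shows "pinching I q (op_mult I (op_mult I A T) B) = op_mult I (op_mult I A (pinching I q T)) B"
proof (rule bounded_op_ext[of _ I])
  fix \<xi> assume \<xi>: "\<xi> \<in> l2 I"
  note mem = bounded_op_closed[OF A(1)] bounded_op_closed[OF B(1)] bounded_op_closed[OF T] restrict_vec_closed
    bounded_op_closed[OF pinching_closed[OF T]]
  have in_block: "restrict_vec {j. q j = q i} \<eta> i = \<eta> i" for \<eta> i
    by (simp add: restrict_vec_def)
  have "A (T (B (restrict_vec {j. q j = q i} \<xi>))) i = A (pinching I q T (B \<xi>)) i" for i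
  proof -
    let ?r = "restrict_vec {j. q j = q i}"
    have "A (T (B (?r \<xi>))) i = ?r (A (T (?r (B \<xi>)))) i"
      by (simp add: in_block B(2) \<xi>)
    also have "\<dots> = A (?r (T (?r (B \<xi>)))) i"
      by (simp add: A(2) \<xi> mem)
    also have "\<dots> = A (?r (pinching I q T (B \<xi>))) i"
      by (simp add: restrict_vec_pinching[OF T] \<xi> mem)
    also have "\<dots> = A (pinching I q T (B \<xi>)) i"
      by (simp add: A(2) \<xi> mem in_block)
    finally show ?thesis .
  qed
  moreover have "A (pinching I q T (B \<xi>)) i = 0" if "i \<notin> I" for i
    by (rule l2_outside[OF _ that]) (simp add: mem \<xi>)
  ultimately show "pinching I q (op_mult I (op_mult I A T) B) \<xi> = op_mult I (op_mult I A (pinching I q T)) B \<xi>"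
    using \<xi> by (auto simp: op_mult_apply mem pinching_def[of _ _ "op_mult I (op_mult I A T) B"] fun_eq_iff)
qed (intro pinching_closed op_mult_closed A B T)+

section \<open>Group von Neumann algebras by matrix coefficients\<close>

context group
begin

lemma mult_inv_cancel_left:
  assumes "g \<in> carrier G" "h \<in> carrier G"
  shows "g \<otimes> (inv g \<otimes> h) = h" and "inv g \<otimes> (g \<otimes> h) = h"
  using assms by (metis inv_closed l_inv l_one m_assoc r_inv)+

lemma bij_betw_left_mult: "g \<in> carrier G \<Longrightarrow> bij_betw (\<lambda>h. g \<otimes> h) (carrier G) (carrier G)"
  by (rule bij_betw_byWitness[where f' = "\<lambda>h. inv g \<otimes> h"]) (auto simp: mult_inv_cancel_left)

lemma bij_betw_right_mult: "g \<in> carrier G \<Longrightarrow> bij_betw (\<lambda>h. h \<otimes> g) (carrier G) (carrier G)"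
  by (rule bij_betw_byWitness[where f' = "\<lambda>h. h \<otimes> inv g"]) (auto simp: m_assoc)

lemma bij_betw_inv_mult: "g \<in> carrier G \<Longrightarrow> bij_betw (\<lambda>h. inv h \<otimes> g) (carrier G) (carrier G)"
  by (rule bij_betw_byWitness[where f' = "\<lambda>h. g \<otimes> inv h"]) (auto simp: m_assoc inv_mult_group mult_inv_cancel_left)

lemma left_regular_eq_reindex_op: "left_regular G g = reindex_op (carrier G) (\<lambda>h. inv g \<otimes> h)"
  by (simp add: left_regular_def reindex_op_def)

lemma left_regular_closed: "g \<in> carrier G \<Longrightarrow> left_regular G g \<in> bounded_ops (carrier G)"
  by (simp add: left_regular_eq_reindex_op reindex_op_closed bij_betw_left_mult)

lemma l2_norm_left_regular:
  "g \<in> carrier G \<Longrightarrow> \<xi> \<in> l2 (carrier G) \<Longrightarrow>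
    l2_norm (carrier G) (left_regular G g \<xi>) = l2_norm (carrier G) \<xi>"
  by (simp add: left_regular_eq_reindex_op l2_norm_reindex_op bij_betw_left_mult)

lemma left_regular_apply:
  "\<xi> \<in> l2 (carrier G) \<Longrightarrow> h \<in> carrier G \<Longrightarrow> left_regular G g \<xi> h = \<xi> (inv g \<otimes> h)"
  by (simp add: left_regular_def)

lemma left_regular_delta:
  assumes "g \<in> carrier G" "h \<in> carrier G"
  shows "left_regular G g (delta h) = delta (g \<otimes> h)"
proof
  fix k
  have "inv g \<otimes> k = h \<longleftrightarrow> k = g \<otimes> h" if "k \<in> carrier G"
    using assms that by (metis inv_solve_left')
  moreover have "left_regular G g (delta h) k = (if k \<in> carrier G then delta h (inv g \<otimes> k) else 0)"
    using assms by (simp add: left_regular_def delta_l2)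
  ultimately show "left_regular G g (delta h) k = delta (g \<otimes> h) k"
    using assms by (auto simp: delta_def)
qed

lemma left_regular_adj:
  assumes "g \<in> carrier G"
  shows "op_adj (carrier G) (left_regular G g) = left_regular G (inv g)"
  unfolding left_regular_eq_reindex_op
  using assms by (intro op_adj_reindex_op) (auto simp: m_assoc[symmetric])

lemma left_regular_mult:
  assumes "g \<in> carrier G" "h \<in> carrier G"
  shows "op_mult (carrier G) (left_regular G g) (left_regular G h) = left_regular G (g \<otimes> h)"
  using assms
  by (intro bounded_op_eqI_delta[of _ "carrier G"] op_mult_closed left_regular_closed)
    (simp_all add: op_mult_apply delta_l2 left_regular_delta m_assoc)

lemma left_regular_one: "left_regular G \<one> = op_one (carrier G)"
  by (rule bounded_op_eqI_delta[of _ "carrier G"]) (auto simp: left_regular_closed op_one_closed left_regular_delta op_one_apply delta_l2)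

lemma left_regular_inj: "inj_on (left_regular G) (carrier G)"
proof (rule inj_onI)
  fix g h assume gh: "g \<in> carrier G" "h \<in> carrier G" "left_regular G g = left_regular G h"
  then have "(delta g :: _ \<Rightarrow> complex) g = delta h g"
    using left_regular_delta[of g \<one>] left_regular_delta[of h \<one>] by simp
  then show "g = h" by (auto simp: delta_def split: if_splits)
qed

lemma left_regular_image_closed:
  "subgroup H G \<Longrightarrow> left_regular G ` H \<subseteq> bounded_ops (carrier G)"
  by (auto simp: left_regular_closed subgroup.mem_carrier)

lemma group_vna_eq_bicommutant:
  assumes "subgroup H G"
  shows "group_vna G H = commutant (carrier G) (commutant (carrier G) (left_regular G ` H))"
  unfolding group_vna_def
  using assms
  by (intro generated_vna_eq_bicommutant)
    (auto simp: left_regular_closed left_regular_adj subgroup.mem_carrier subgroup.m_inv_closed)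

lemma group_vna_closed:
  assumes H: "subgroup H G"
  shows group_vna_bounded: "x \<in> group_vna G H \<Longrightarrow> x \<in> bounded_ops (carrier G)"
    and left_regular_in_group_vna: "s \<in> H \<Longrightarrow> left_regular G s \<in> group_vna G H"
    and group_vna_mult: "x \<in> group_vna G H \<Longrightarrow> y \<in> group_vna G H \<Longrightarrow> op_mult (carrier G) x y \<in> group_vna G H"
    and group_vna_add: "x \<in> group_vna G H \<Longrightarrow> y \<in> group_vna G H \<Longrightarrow> op_add (carrier G) x y \<in> group_vna G H"
    and group_vna_scale: "x \<in> group_vna G H \<Longrightarrow> op_scale (carrier G) c x \<in> group_vna G H"
    and group_vna_one: "op_one (carrier G) \<in> group_vna G H"
    and group_vna_adj: "x \<in> group_vna G H \<Longrightarrow> op_adj (carrier G) x \<in> group_vna G H"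
  unfolding group_vna_eq_bicommutant[OF H]
proof -
  let ?X = "left_regular G ` H" and ?I = "carrier G"
  show "x \<in> commutant ?I (commutant ?I ?X) \<Longrightarrow> x \<in> bounded_ops ?I"
    by (simp add: commutant_def)
  show "s \<in> H \<Longrightarrow> left_regular G s \<in> commutant ?I (commutant ?I ?X)"
    using subset_bicommutant[OF left_regular_image_closed[OF H]] by blast
  have "op_adj ?I S \<in> ?X" if "S \<in> ?X" for S
    using that H by (auto simp: left_regular_adj subgroup.mem_carrier subgroup.m_inv_closed)
  then show "x \<in> commutant ?I (commutant ?I ?X) \<Longrightarrow> op_adj ?I x \<in> commutant ?I (commutant ?I ?X)"
    by (intro commutant_adj_closed commutant_bounded left_regular_image_closed H)
qed (simp_all add: commutant_mult commutant_add commutant_scale commutant_one commutant_bounded)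

lemma group_vna_mono:
  assumes "subgroup H G" "subgroup K G" "H \<subseteq> K"
  shows "group_vna G H \<subseteq> group_vna G K"
  unfolding group_vna_eq_bicommutant[OF assms(1)] group_vna_eq_bicommutant[OF assms(2)]
  by (intro commutant_antimono image_mono assms(3))

lemma group_vna_commute:
  assumes H: "subgroup H G" and comm: "\<And>s t. s \<in> H \<Longrightarrow> t \<in> H \<Longrightarrow> s \<otimes> t = t \<otimes> s"
    and "x \<in> group_vna G H" "y \<in> group_vna G H"
  shows "op_mult (carrier G) x y = op_mult (carrier G) y x"
proof -
  let ?X = "left_regular G ` H" and ?I = "carrier G"
  have "?X \<subseteq> commutant ?I ?X"
    using H comm by (auto simp: commutant_def left_regular_closed left_regular_mult subgroup.mem_carrier)
  then have "commutant ?I (commutant ?I ?X) \<subseteq> commutant ?I ?X"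
    by (rule commutant_antimono)
  then show ?thesis
    using assms(3,4) unfolding group_vna_eq_bicommutant[OF H] commutant_def[of _ "commutant _ _"] by blast
qed

text \<open>
  Right translations commute with \<open>left_regular\<close>, hence with the generated algebra, and carry $\delta_1$ to any
  other basis vector.
\<close>

lemma group_vna_entry:
  assumes H: "subgroup H G" and x: "x \<in> group_vna G H" and g: "g \<in> carrier G" and h: "h \<in> carrier G"
  shows "x (delta h) g = x (delta \<one>) (g \<otimes> inv h)"
proof -
  define R where "R = reindex_op (carrier G) (\<lambda>j. j \<otimes> inv h)"
  have R: "R \<in> bounded_ops (carrier G)"
    unfolding R_def using h by (intro reindex_op_closed bij_betw_right_mult) simp
  have R_apply: "R \<xi> j = (if j \<in> carrier G then \<xi> (j \<otimes> inv h) else 0)" if "\<xi> \<in> l2 (carrier G)" for \<xi> j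
    using that by (simp add: R_def reindex_op_def)
  have "R \<in> commutant (carrier G) (left_regular G ` H)"
  proof (rule commutantI[OF R left_regular_image_closed[OF H]], clarify)
    fix s \<xi> assume "s \<in> H" and \<xi>: "\<xi> \<in> l2 (carrier G)"
    then have s: "s \<in> carrier G" using subgroup.mem_carrier[OF H] by blast
    show "left_regular G s (R \<xi>) = R (left_regular G s \<xi>)"
      using s h \<xi> bounded_op_closed[OF R \<xi>] bounded_op_closed[OF left_regular_closed[OF s] \<xi>]
      by (auto simp: fun_eq_iff left_regular_def[of G s] R_apply m_assoc)
  qed
  then have "R (x (delta \<one>)) = x (R (delta \<one>))"
    using x by (intro commutant_apply) (auto simp: group_vna_eq_bicommutant[OF H] delta_l2)
  moreover have "R (delta \<one>) = delta h"
  proof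
    fix j
    have "j \<otimes> inv h = \<one> \<longleftrightarrow> j = h" if "j \<in> carrier G"
      using that h by (metis inv_closed inv_equality inv_inv r_inv)
    moreover have "R (delta \<one>) j = (if j \<in> carrier G then delta \<one> (j \<otimes> inv h) else 0)"
      by (simp add: R_apply delta_l2)
    ultimately show "R (delta \<one>) j = delta h j" using h by (auto simp: delta_def)
  qed
  ultimately have "x (delta h) g = R (x (delta \<one>)) g" by simp
  then show ?thesis
    using g by (simp add: R_apply bounded_op_closed[OF group_vna_bounded[OF H x]] delta_l2)
qed

text \<open>
  The projection onto the coordinates in an \<open>H\<close>-invariant set commutes with $\lambda(H)$.
\<close>

lemma group_vna_restrict:
  assumes H: "subgroup H G" and x: "x \<in> group_vna G H" and \<xi>: "\<xi> \<in> l2 (carrier G)"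
    and B: "\<And>s h. s \<in> H \<Longrightarrow> h \<in> carrier G \<Longrightarrow> s \<otimes> h \<in> B \<longleftrightarrow> h \<in> B"
  shows "x (restrict_vec B \<xi>) = restrict_vec B (x \<xi>)"
proof -
  have "coord_proj (carrier G) B \<in> commutant (carrier G) (left_regular G ` H)"
  proof (rule commutantI[OF coord_proj_closed left_regular_image_closed[OF H]], clarify)
    fix s \<xi> assume s: "s \<in> H" and \<xi>: "\<xi> \<in> l2 (carrier G)"
    have sc: "s \<in> carrier G" using s subgroup.mem_carrier[OF H] by blast
    have "inv s \<otimes> h \<in> B \<longleftrightarrow> h \<in> B" if "h \<in> carrier G" for h
      using B[OF subgroup.m_inv_closed[OF H s] that] .
    then show "left_regular G s (coord_proj (carrier G) B \<xi>) = coord_proj (carrier G) B (left_regular G s \<xi>)"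
      using \<xi> bounded_op_closed[OF left_regular_closed[OF sc] \<xi>] restrict_vec_closed[OF \<xi>, of B]
      by (auto simp: fun_eq_iff coord_proj_apply left_regular_def[of G s]) (auto simp: restrict_vec_def)
  qed
  then have "coord_proj (carrier G) B (x \<xi>) = x (coord_proj (carrier G) B \<xi>)"
    using x \<xi> by (intro commutant_apply) (auto simp: group_vna_eq_bicommutant[OF H])
  then show ?thesis
    by (simp add: coord_proj_apply \<xi> bounded_op_closed[OF group_vna_bounded[OF H x]])
qed

lemma subgroup_left_mult_mem:
  assumes "subgroup H G" "s \<in> H" "h \<in> carrier G"
  shows "s \<otimes> h \<in> H \<longleftrightarrow> h \<in> H"
proof
  assume "s \<otimes> h \<in> H"
  then have "inv s \<otimes> (s \<otimes> h) \<in> H"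
    using assms by (simp add: subgroup.m_closed subgroup.m_inv_closed)
  then show "h \<in> H" using assms by (simp add: mult_inv_cancel_left subgroup.mem_carrier)
qed (use assms in \<open>simp add: subgroup.m_closed\<close>)

lemma group_vna_support:
  assumes H: "subgroup H G" and x: "x \<in> group_vna G H" and g: "g \<notin> H"
  shows "x (delta \<one>) g = 0"
proof -
  have "restrict_vec H (delta \<one>) = (delta \<one> :: _ \<Rightarrow> complex)"
    using subgroup.one_closed[OF H] by (auto simp: restrict_vec_def delta_def)
  then have "x (delta \<one>) = restrict_vec H (x (delta \<one>))"
    using group_vna_restrict[OF H x delta_l2[OF one_closed] subgroup_left_mult_mem[OF H]] by simp
  then show ?thesis using g by (metis restrict_vec_def)
qed

text \<open>
  Let \<open>T\<close> commute with $\lambda(H)$, so that its matrix satisfies $T(sg,sh) = T(g,h)$ for \<open>s\<close> in \<open>H\<close>. Multiplying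
  matrices, the entries of both \<open>T x\<close> and \<open>x T\<close> at \<open>(g, h)\<close> reduce to
  $\sum_{s\in H} f(s)\,T(g,sh)$. Hence \<open>x\<close> lies in the bicommutant.
\<close>

lemma group_vnaI:
  assumes H: "subgroup H G" and x: "x \<in> bounded_ops (carrier G)"
    and entry: "\<And>g h. g \<in> carrier G \<Longrightarrow> h \<in> carrier G \<Longrightarrow> x (delta h) g = f (g \<otimes> inv h)"
    and supp: "\<And>g. g \<notin> H \<Longrightarrow> f g = 0"
  shows "x \<in> group_vna G H"
  unfolding group_vna_eq_bicommutant[OF H] commutant_def[of _ "commutant _ _"]
proof (intro CollectI conjI ballI x)
  let ?I = "carrier G"
  fix T assume T: "T \<in> commutant ?I (left_regular G ` H)"
  then have Tb: "T \<in> bounded_ops ?I" by (simp add: commutant_def)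
  show "op_mult ?I T x = op_mult ?I x T"
  proof (rule bounded_op_eqI_delta[OF op_mult_closed[OF Tb x] op_mult_closed[OF x Tb]])
    fix g h assume g: "g \<in> ?I" and h: "h \<in> ?I"
    have "op_mult ?I T x (delta h) g = (\<Sum>\<^sub>\<infinity>k\<in>?I. T (delta k) g * f (k \<otimes> inv h))"
      using bounded_op_eq_infsum[OF Tb bounded_op_closed[OF x delta_l2[OF h]] g]
      by (simp add: op_mult_apply delta_l2 h entry cong: infsum_cong)
    also have "\<dots> = (\<Sum>\<^sub>\<infinity>s\<in>?I. T (delta (s \<otimes> h)) g * f ((s \<otimes> h) \<otimes> inv h))"
      by (rule infsum_reindex_bij_betw[OF bij_betw_right_mult[OF h], symmetric])
    also have "\<dots> = (\<Sum>\<^sub>\<infinity>s\<in>?I. f (g \<otimes> inv (inv s \<otimes> g)) * T (delta h) (inv s \<otimes> g))"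
    proof (rule infsum_cong)
      fix s assume s: "s \<in> ?I"
      have eqs: "(s \<otimes> h) \<otimes> inv h = s" "g \<otimes> inv (inv s \<otimes> g) = s"
        using s g h by (simp_all add: m_assoc inv_mult_group) (simp add: m_assoc[symmetric])
      show "T (delta (s \<otimes> h)) g * f ((s \<otimes> h) \<otimes> inv h)
          = f (g \<otimes> inv (inv s \<otimes> g)) * T (delta h) (inv s \<otimes> g)"
      proof (cases "s \<in> H")
        case True
        have "T (delta (s \<otimes> h)) g = left_regular G s (T (delta h)) g"
          using commutant_apply[OF T imageI[OF True] delta_l2[OF h]] s h by (simp add: left_regular_delta)
        also have "\<dots> = T (delta h) (inv s \<otimes> g)"
          using g h by (simp add: left_regular_apply bounded_op_closed[OF Tb] delta_l2)
        finally show ?thesis unfolding eqs by simp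
      qed (unfold eqs, simp add: supp)
    qed
    also have "\<dots> = (\<Sum>\<^sub>\<infinity>k\<in>?I. f (g \<otimes> inv k) * T (delta h) k)"
      by (rule infsum_reindex_bij_betw[OF bij_betw_inv_mult[OF g]])
    also have "\<dots> = op_mult ?I x T (delta h) g"
      using bounded_op_eq_infsum[OF x bounded_op_closed[OF Tb delta_l2[OF h]] g]
      by (simp add: op_mult_apply delta_l2 h g entry cong: infsum_cong)
    finally show "op_mult ?I T x (delta h) g = op_mult ?I x T (delta h) g" .
  qed
qed

section \<open>The conditional expectation onto the algebra of a subgroup\<close>

lemma r_coset_eq_iff:
  assumes "subgroup H G" "g \<in> carrier G" "h \<in> carrier G"
  shows "H #> g = H #> h \<longleftrightarrow> g \<otimes> inv h \<in> H"
proof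
  assume "H #> g = H #> h"
  then have "g \<in> H #> h" using rcos_self[OF assms(2,1)] by simp
  then obtain s where "s \<in> H" "g = s \<otimes> h" by (auto simp: r_coset_def)
  then show "g \<otimes> inv h \<in> H" using assms by (simp add: m_assoc subgroup.mem_carrier)
next
  assume "g \<otimes> inv h \<in> H"
  then have "(g \<otimes> inv h) \<otimes> h \<in> H #> h" by (auto simp: r_coset_def)
  then have "g \<in> H #> h" using assms by (simp add: m_assoc)
  then show "H #> g = H #> h" using repr_independence assms by metis
qed

lemma group_trace_eq: "group_trace G x = x (delta \<one>) \<one>"
  by (simp add: group_trace_def l2_inner_delta)

lemma norm2_group_trace:
  assumes "x \<in> bounded_ops (carrier G)"
  shows "norm2 (carrier G) (group_trace G) x = l2_norm (carrier G) (x (delta \<one>))"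
proof -
  have m: "delta \<one> \<in> l2 (carrier G)" "x (delta \<one>) \<in> l2 (carrier G)"
    using bounded_op_closed[OF assms] by (auto simp: delta_l2)
  have "group_trace G (op_mult (carrier G) (op_adj (carrier G) x) x)
      = l2_inner (carrier G) (x (delta \<one>)) (x (delta \<one>))"
    by (simp add: group_trace_def op_mult_apply m op_adj_inner'[OF assms])
  then show ?thesis by (simp add: norm2_def l2_inner_self[OF m(2)])
qed

text \<open>
  Entries with both indices in one coset \<open>H g\<close> are those at $(g, h)$ with $gh^{-1}$ in \<open>H\<close>, so the block
  diagonal part of \<open>x\<close> again has the matrix of an element of the algebra of \<open>H\<close>. The module property holds because
  the projections onto the right cosets commute with that algebra.
\<close>

lemma conditional_expectation_pinching:
  assumes H: "subgroup H G"
  shows "conditional_expectation (carrier G) (group_trace G) (group_vna G (carrier G)) (group_vna G H)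
    (pinching (carrier G) (\<lambda>g. H #> g))"
  unfolding conditional_expectation_def
proof (intro conjI ballI impI)
  let ?I = "carrier G" and ?q = "\<lambda>g. H #> g"
  let ?M = "group_vna G ?I" and ?A = "group_vna G H" and ?E = "pinching ?I ?q"
  note M_bounded = group_vna_bounded[OF subgroup_self] and A_bounded = group_vna_bounded[OF H]
  have block: "a (restrict_vec {j. ?q j = c} \<xi>) = restrict_vec {j. ?q j = c} (a \<xi>)"
    if "a \<in> ?A" "\<xi> \<in> l2 ?I" for a c \<xi>
  proof (rule group_vna_restrict[OF H that])
    fix s h assume "s \<in> H" "h \<in> ?I"
    then show "s \<otimes> h \<in> {j. H #> j = c} \<longleftrightarrow> h \<in> {j. H #> j = c}"
      using H coset_mult_assoc[of H s h] coset_join2[of s H]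
      by (simp add: subgroup.subset subgroup.mem_carrier)
  qed
  show "?E \<in> ?M \<rightarrow> ?A"
  proof
    fix x assume x: "x \<in> ?M"
    show "?E x \<in> ?A"
    proof (rule group_vnaI[OF H pinching_closed[OF M_bounded[OF x]]])
      fix g h assume gh: "g \<in> ?I" "h \<in> ?I"
      then show "?E x (delta h) g = (if g \<otimes> inv h \<in> H then x (delta \<one>) (g \<otimes> inv h) else 0)"
        using group_vna_entry[OF subgroup_self x gh]
        by (simp add: pinching_delta[OF M_bounded[OF x]] r_coset_eq_iff[OF H])
    qed simp
  qed
  show "op_linear_on ?I ?M ?E"
    unfolding op_linear_on_def
  proof (intro conjI ballI allI)
    fix x y
    show "?E (op_add ?I x y) = op_add ?I (?E x) (?E y)"
      unfolding pinching_def op_add_def by (rule restrict_ext) (auto simp: restrict_vec_closed)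
  next
    fix c x
    show "?E (op_scale ?I c x) = op_scale ?I c (?E x)"
      unfolding pinching_def op_scale_def by (rule restrict_ext) (auto simp: restrict_vec_closed)
  qed
  {
    fix x assume x: "x \<in> ?M"
    show "group_trace G (?E x) = group_trace G x"
      by (simp add: group_trace_eq pinching_delta[OF M_bounded[OF x]])
    show "op_positive ?I x \<Longrightarrow> op_positive ?I (?E x)"
      by (rule pinching_positive[OF M_bounded[OF x]])
  }
  fix a assume a: "a \<in> ?A"
  show "?E a = a"
  proof (rule bounded_op_eqI_delta[OF pinching_closed[OF A_bounded[OF a]] A_bounded[OF a]])
    fix g h assume gh: "g \<in> ?I" "h \<in> ?I"
    then show "?E a (delta h) g = a (delta h) g"
      using group_vna_entry[OF H a gh] group_vna_support[OF H a]
      by (simp add: pinching_delta[OF A_bounded[OF a]] r_coset_eq_iff[OF H])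
  qed
  fix b x assume b: "b \<in> ?A" and x: "x \<in> ?M"
  show "?E (op_mult ?I (op_mult ?I a x) b) = op_mult ?I (op_mult ?I a (?E x)) b"
    by (intro pinching_bimodule A_bounded M_bounded block a b x)
qed

text \<open>
  The conditional expectation axioms determine the vector of \<open>E x\<close>: for \<open>s\<close> in \<open>H\<close> its coefficient at \<open>s\<close> is
  the trace of $\lambda_{s^{-1}} E(x) = E(\lambda_{s^{-1}} x)$, which is the trace of $\lambda_{s^{-1}} x$. So it does
  not matter which expectation the choice operator in \<open>cond_exp\<close> selects.
\<close>

lemma conditional_expectation_delta:
  assumes H: "subgroup H G"
    and E: "conditional_expectation (carrier G) (group_trace G) (group_vna G (carrier G)) (group_vna G H) E"
    and x: "x \<in> group_vna G (carrier G)"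
  shows "E x (delta \<one>) = restrict_vec H (x (delta \<one>))"
proof
  let ?I = "carrier G" and ?M = "group_vna G (carrier G)" and ?A = "group_vna G H"
  fix s
  have Ex: "E x \<in> ?A" using E x by (auto simp: conditional_expectation_def)
  have tr: "group_trace G (op_mult ?I (op_mult ?I (left_regular G (inv s)) y) (op_one ?I)) = y (delta \<one>) s"
    if s: "s \<in> H" and y: "y \<in> bounded_ops ?I" for y
  proof -
    have "y (delta \<one>) \<in> l2 ?I" using bounded_op_closed[OF y] by (simp add: delta_l2)
    then show ?thesis
      using subgroup.mem_carrier[OF H s]
      by (simp add: group_trace_eq op_mult_apply delta_l2 op_one_apply left_regular_apply)
  qed
  show "E x (delta \<one>) s = restrict_vec H (x (delta \<one>)) s"
  proof (cases "s \<in> H")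
    case True
    have a: "left_regular G (inv s) \<in> ?A" "op_one ?I \<in> ?A"
      using left_regular_in_group_vna[OF H] group_vna_one[OF H] subgroup.m_inv_closed[OF H True] by auto
    then have aM: "left_regular G (inv s) \<in> ?M" "op_one ?I \<in> ?M"
      using group_vna_mono[OF H subgroup_self subgroup.subset[OF H]] by auto
    let ?y = "op_mult ?I (op_mult ?I (left_regular G (inv s)) x) (op_one ?I)"
    have "?y \<in> ?M" by (intro group_vna_mult[OF subgroup_self] aM x)
    then have "group_trace G (E ?y) = group_trace G ?y"
      using E by (simp add: conditional_expectation_def)
    moreover have "E ?y = op_mult ?I (op_mult ?I (left_regular G (inv s)) (E x)) (op_one ?I)"
      using E a x by (simp add: conditional_expectation_def)
    ultimately show ?thesis
      using tr[OF True group_vna_bounded[OF H Ex]] tr[OF True group_vna_bounded[OF subgroup_self x]] True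
      by (simp add: restrict_vec_def)
  next
    case False
    then show ?thesis using group_vna_support[OF H Ex] by (simp add: restrict_vec_def)
  qed
qed

lemma cond_exp_group_vna:
  assumes H: "subgroup H G" and x: "x \<in> group_vna G (carrier G)"
  defines "E \<equiv> cond_exp (carrier G) (group_trace G) (group_vna G (carrier G)) (group_vna G H)"
  shows cond_exp_in: "E x \<in> group_vna G H"
    and cond_exp_delta: "E x (delta \<one>) = restrict_vec H (x (delta \<one>))"
proof -
  have E: "conditional_expectation (carrier G) (group_trace G) (group_vna G (carrier G)) (group_vna G H) E"
    unfolding E_def cond_exp_def using conditional_expectation_pinching[OF H] by (rule someI[of "conditional_expectation _ _ _ _"])
  then show "E x \<in> group_vna G H" using x by (auto simp: conditional_expectation_def)
  show "E x (delta \<one>) = restrict_vec H (x (delta \<one>))"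
    by (rule conditional_expectation_delta[OF H E x])
qed

end

section \<open>Weak convergence and almost orthonormal sets\<close>

text \<open>
  Convergence along this filter is the notion of limit "outside finite subsets of \<open>S\<close>" that occurs in the
  definitions of almost orthonormal sets and of strong mixing.
\<close>

definition cofinite_on :: "'a set \<Rightarrow> 'a filter" where
  "cofinite_on S = inf cofinite (principal S)"

lemma eventually_cofinite_on:
  "eventually P (cofinite_on S) \<longleftrightarrow> finite {u \<in> S. \<not> P u}"
  by (simp add: cofinite_on_def eventually_inf_principal eventually_cofinite)

lemma eventually_cofinite_on_iff_ex:
  "eventually P (cofinite_on S) \<longleftrightarrow> (\<exists>F. finite F \<and> F \<subseteq> S \<and> (\<forall>u\<in>S - F. P u))"
  unfolding eventually_cofinite_on
proof
  assume "finite {u \<in> S. \<not> P u}"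
  then show "\<exists>F. finite F \<and> F \<subseteq> S \<and> (\<forall>u\<in>S - F. P u)"
    by (intro exI[of _ "{u \<in> S. \<not> P u}"]) auto
next
  assume "\<exists>F. finite F \<and> F \<subseteq> S \<and> (\<forall>u\<in>S - F. P u)"
  then obtain F where "finite F" "\<forall>u\<in>S - F. P u" by blast
  then show "finite {u \<in> S. \<not> P u}" by (auto intro: finite_subset[of _ F])
qed

lemma eventually_mem_cofinite_on: "(\<And>u. u \<in> S \<Longrightarrow> P u) \<Longrightarrow> eventually P (cofinite_on S)"
  by (simp add: cofinite_on_def eventually_inf_principal)

lemma cofinite_on_neq_bot: "infinite S \<Longrightarrow> cofinite_on S \<noteq> bot"
  by (simp add: trivial_limit_def eventually_cofinite_on)

lemma filterlim_cofinite_on: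
  assumes "inj_on f S" "f ` S \<subseteq> T"
  shows "filterlim f (cofinite_on T) (cofinite_on S)"
  unfolding filterlim_iff
proof (intro allI impI)
  fix P assume "eventually P (cofinite_on T)"
  then have "finite {v \<in> T. \<not> P v}" by (simp add: eventually_cofinite_on)
  moreover have "f ` {u \<in> S. \<not> P (f u)} \<subseteq> {v \<in> T. \<not> P v}" using assms(2) by auto
  ultimately have "finite (f ` {u \<in> S. \<not> P (f u)})" by (rule finite_subset[rotated])
  then have "finite {u \<in> S. \<not> P (f u)}"
    by (rule finite_imageD) (rule inj_on_subset[OF assms(1)], auto)
  then show "\<forall>\<^sub>F u in cofinite_on S. P (f u)" by (simp add: eventually_cofinite_on)
qed

lemma l2_tendsto_zero:
  assumes "\<xi> \<in> l2 I"
  shows "(\<xi> \<longlongrightarrow> 0) (cofinite_on I)"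
proof (rule tendstoI)
  fix \<epsilon> :: real assume "0 < \<epsilon>"
  then obtain F where F: "finite F" "F \<subseteq> I" "l2_norm I (restrict_vec (- F) \<xi>) \<le> \<epsilon> / 2"
    using l2_tail_small[OF assms, of "\<epsilon> / 2"] by auto
  have "cmod (\<xi> i) < \<epsilon>" if "i \<notin> F" for i
    using cmod_le_l2_norm[OF restrict_vec_closed[OF assms], of "- F" i] F(3) \<open>0 < \<epsilon>\<close> that
    by (simp add: restrict_vec_apply)
  with F(1,2) show "\<forall>\<^sub>F i in cofinite_on I. dist (\<xi> i) 0 < \<epsilon>"
    unfolding eventually_cofinite_on_iff_ex by (intro exI[of _ F]) auto
qed

text \<open>
  On bounded sets of operators the weak operator topology agrees with the ultraweak one: the series of a subbasic
  set has terms bounded by $|K|(\|\xi_n\|^2 + \|\eta_n\|^2)$, so limits may be taken term by term.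
\<close>

lemma limitin_ultraweak_topology:
  assumes bounded: "\<forall>\<^sub>F u in F. U u \<in> bounded_ops I \<and> (\<forall>\<xi>\<in>l2 I. l2_norm I (U u \<xi>) \<le> K * l2_norm I \<xi>)"
    and T: "T \<in> bounded_ops I"
    and weak: "\<And>\<xi> \<eta>. \<xi> \<in> l2 I \<Longrightarrow> \<eta> \<in> l2 I \<Longrightarrow>
        ((\<lambda>u. l2_inner I (U u \<xi>) \<eta>) \<longlongrightarrow> l2_inner I (T \<xi>) \<eta>) F"
    and nontrivial: "F \<noteq> bot"
  shows "limitin (ultraweak_topology I) U T F"
proof -
  let ?S = "{{T \<in> bounded_ops I. (\<Sum>n. l2_inner I (T (\<xi> n)) (\<eta> n)) \<in> W} | \<xi> \<eta> W.
        range \<xi> \<subseteq> l2 I \<and> summable (\<lambda>n::nat. (l2_norm I (\<xi> n))\<^sup>2) \<and>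
        range \<eta> \<subseteq> l2 I \<and> summable (\<lambda>n::nat. (l2_norm I (\<eta> n))\<^sup>2) \<and> open W}"
  have series: "((\<lambda>u. \<Sum>n. l2_inner I (U u (\<xi> n)) (\<eta> n)) \<longlongrightarrow> (\<Sum>n. l2_inner I (T (\<xi> n)) (\<eta> n))) F"
    if \<xi>: "range \<xi> \<subseteq> l2 I" "summable (\<lambda>n::nat. (l2_norm I (\<xi> n))\<^sup>2)"
      and \<eta>: "range \<eta> \<subseteq> l2 I" "summable (\<lambda>n::nat. (l2_norm I (\<eta> n))\<^sup>2)" for \<xi> \<eta>
  proof -
    let ?M = "\<lambda>n. \<bar>K\<bar> * ((l2_norm I (\<xi> n))\<^sup>2 + (l2_norm I (\<eta> n))\<^sup>2)"
    have mem: "\<xi> n \<in> l2 I" "\<eta> n \<in> l2 I" for n using \<xi>(1) \<eta>(1) by auto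
    have bound: "norm (l2_inner I (U u (\<xi> n)) (\<eta> n)) \<le> ?M n"
      if "U u \<in> bounded_ops I" "\<forall>\<xi>\<in>l2 I. l2_norm I (U u \<xi>) \<le> K * l2_norm I \<xi>" for u n
    proof -
      let ?a = "l2_norm I (\<xi> n)" and ?b = "l2_norm I (\<eta> n)"
      have "norm (l2_inner I (U u (\<xi> n)) (\<eta> n)) \<le> l2_norm I (U u (\<xi> n)) * ?b"
        by (intro cauchy_schwarz bounded_op_closed[OF that(1)] mem)
      also have "\<dots> \<le> (K * ?a) * ?b"
        using that(2) mem(1) by (intro mult_right_mono) auto
      also have "\<dots> \<le> (\<bar>K\<bar> * ?a) * ?b"
        by (intro mult_right_mono) auto
      also have "\<dots> = \<bar>K\<bar> * (?a * ?b)" by simp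
      also have "?a * ?b \<le> ?a\<^sup>2 + ?b\<^sup>2"
        using sum_squares_bound[of ?a ?b] mult_nonneg_nonneg[of ?a ?b] l2_norm_nonneg[of I "\<xi> n"]
          l2_norm_nonneg[of I "\<eta> n"] by linarith
      finally show ?thesis by (simp add: mult_left_mono)
    qed
    have "\<forall>\<^sub>F u in F. \<forall>n. norm (l2_inner I (U u (\<xi> n)) (\<eta> n)) \<le> ?M n"
      using bounded by eventually_elim (use bound in blast)
    then have "\<forall>\<^sub>F (n, u) in at_top \<times>\<^sub>F F. norm (l2_inner I (U u (\<xi> n)) (\<eta> n)) \<le> ?M n"
      unfolding eventually_prod_filter
      by (intro exI[of _ "\<lambda>_. True"]
          exI[of _ "\<lambda>u. \<forall>n. norm (l2_inner I (U u (\<xi> n)) (\<eta> n)) \<le> ?M n"]) auto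
    moreover have "summable ?M"
      by (intro summable_mult summable_add \<xi>(2) \<eta>(2))
    ultimately show ?thesis
      using tannerys_theorem[of "\<lambda>n u. l2_inner I (U u (\<xi> n)) (\<eta> n)"
          "\<lambda>n. l2_inner I (T (\<xi> n)) (\<eta> n)" F ?M] weak[OF mem] nontrivial by blast
  qed
  have nhd: "T \<in> V \<Longrightarrow> \<forall>\<^sub>F u in F. U u \<in> V" if "generate_topology_on ?S V" for V
    using that
  proof (induction V rule: generate_topology_on.induct)
    case (Int a b)
    then show ?case by (simp add: eventually_conj)
  next
    case (UN \<V>)
    then obtain V where V: "V \<in> \<V>" "T \<in> V" by blast
    show ?case by (rule eventually_mono[OF UN.IH[OF V]]) (use V(1) in blast)
  next
    case (Basis V)
    then obtain \<xi> \<eta> W where V: "V = {T \<in> bounded_ops I. (\<Sum>n. l2_inner I (T (\<xi> n)) (\<eta> n)) \<in> W}"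
      and m: "range \<xi> \<subseteq> l2 I" "summable (\<lambda>n::nat. (l2_norm I (\<xi> n))\<^sup>2)"
        "range \<eta> \<subseteq> l2 I" "summable (\<lambda>n::nat. (l2_norm I (\<eta> n))\<^sup>2)" and W: "open W" by blast
    have "\<forall>\<^sub>F u in F. (\<Sum>n. l2_inner I (U u (\<xi> n)) (\<eta> n)) \<in> W"
      using topological_tendstoD[OF series[OF m] W] Basis.prems V by simp
    with bounded show ?case by eventually_elim (simp add: V)
  qed simp
  have "T \<in> topspace (ultraweak_topology I)"
  proof -
    have "bounded_ops I \<in> ?S"
      by (rule CollectI, rule exI[of _ "\<lambda>_ _. 0"], rule exI[of _ "\<lambda>_ _. 0"], rule exI[of _ UNIV]) auto
    then show ?thesis using T unfolding ultraweak_topology_def by auto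
  qed
  then show ?thesis
    unfolding limitin_def ultraweak_topology_def openin_topology_generated_by_iff
    using nhd by blast
qed

lemma coefficient_in_predual:
  assumes N: "N \<subseteq> bounded_ops I" and \<xi>: "\<xi> \<in> l2 I" and \<eta>: "\<eta> \<in> l2 I"
  shows "(\<lambda>T. l2_inner I (T \<xi>) \<eta>) \<in> predual I N"
  unfolding predual_def
proof (intro CollectI conjI)
  have T\<xi>: "T \<xi> \<in> l2 I" if "T \<in> N" for T
    using that N bounded_op_closed \<xi> by blast
  then show "functional_on I N (\<lambda>T. l2_inner I (T \<xi>) \<eta>)"
    unfolding functional_on_def op_add_def op_scale_def
    by (simp add: \<xi> \<eta> l2_inner_add_left l2_inner_scale_left)
  \<comment> \<open>A single coefficient is a series with all terms but the first equal to zero.\<close>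
  let ?\<xi> = "\<lambda>n::nat. if n = 0 then \<xi> else (\<lambda>i. 0)" and ?\<eta> = "\<lambda>n::nat. if n = 0 then \<eta> else (\<lambda>i. 0)"
  have series: "(\<Sum>n. l2_inner I (T (?\<xi> n)) (?\<eta> n)) = l2_inner I (T \<xi>) \<eta>" for T
    using suminf_finite[of "{0}" "\<lambda>n. l2_inner I (T (?\<xi> n)) (?\<eta> n)"] by (simp add: l2_inner_def)
  have norms: "summable (\<lambda>n. (l2_norm I (?\<xi> n))\<^sup>2)" "summable (\<lambda>n. (l2_norm I (?\<eta> n))\<^sup>2)"
    by (rule summable_finite[of "{0}"]; simp)+
  have "openin (ultraweak_topology I) {T \<in> bounded_ops I. l2_inner I (T \<xi>) \<eta> \<in> W}" if "open W" for W
    unfolding ultraweak_topology_def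
  proof (rule topology_generated_by_Basis, rule CollectI, intro exI conjI)
    show "{T \<in> bounded_ops I. l2_inner I (T \<xi>) \<eta> \<in> W}
        = {T \<in> bounded_ops I. (\<Sum>n. l2_inner I (T (?\<xi> n)) (?\<eta> n)) \<in> W}"
      by (simp only: series)
  qed (use \<xi> \<eta> that norms in auto)
  then have op: "openin (subtopology (ultraweak_topology I) N) (N \<inter> {T \<in> bounded_ops I. l2_inner I (T \<xi>) \<eta> \<in> W})"
    if "open W" for W
    using that by (simp add: openin_subtopology_Int2)
  then have "openin (subtopology (ultraweak_topology I) N) N"
    using N openin_subtopology_self op[OF open_UNIV] by (simp add: inf.absorb1)
  then have "topspace (subtopology (ultraweak_topology I) N) = N"
    by (simp add: openin_subset subset_antisym topspace_subtopology_subset inf.absorb2 openin_topspace)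
       (metis Int_lower2 openin_subset subset_antisym topspace_subtopology)
  moreover have "{T \<in> N. l2_inner I (T \<xi>) \<eta> \<in> W} = N \<inter> {T \<in> bounded_ops I. l2_inner I (T \<xi>) \<eta> \<in> W}" for W
    using N by auto
  ultimately show "continuous_map (subtopology (ultraweak_topology I) N) euclidean (\<lambda>T. l2_inner I (T \<xi>) \<eta>)"
    using op by (simp add: continuous_map)
qed

lemma almost_orthonormal_coefficient:
  assumes "almost_orthonormal I N S" "N \<subseteq> bounded_ops I" "\<xi> \<in> l2 I" "\<eta> \<in> l2 I"
  shows "((\<lambda>u. l2_inner I (u \<xi>) \<eta>) \<longlongrightarrow> 0) (cofinite_on S)"
proof (rule tendstoI)
  fix \<epsilon> :: real assume "0 < \<epsilon>"
  then obtain F where F: "finite F" "F \<subseteq> S" "\<forall>u\<in>S - F. cmod (l2_inner I (u \<xi>) \<eta>) \<le> \<epsilon> / 2"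
    using assms(1) coefficient_in_predual[OF assms(2-4)] unfolding almost_orthonormal_def
    by (metis half_gt_zero)
  have "dist (l2_inner I (u \<xi>) \<eta>) 0 < \<epsilon>" if "u \<in> S - F" for u
    using bspec[OF F(3) that] \<open>0 < \<epsilon>\<close> by simp
  with F(1,2) show "\<forall>\<^sub>F u in cofinite_on S. dist (l2_inner I (u \<xi>) \<eta>) 0 < \<epsilon>"
    unfolding eventually_cofinite_on_iff_ex by blast
qed

lemma unitary_isometry:
  assumes "u \<in> carrier (unitary_group I N)" "N \<subseteq> bounded_ops I" "\<xi> \<in> l2 I"
  shows l2_norm_unitary: "l2_norm I (u \<xi>) = l2_norm I \<xi>"
    and l2_norm_unitary_adj: "l2_norm I (op_adj I u \<xi>) = l2_norm I \<xi>"
    and unitary_adj_apply: "u (op_adj I u \<xi>) = \<xi>"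
proof -
  have u: "u \<in> bounded_ops I" and inv: "op_mult I (op_adj I u) u = op_one I" "op_mult I u (op_adj I u) = op_one I"
    using assms(1,2) by (auto simp: unitary_group_def)
  have ap: "op_adj I u (u \<xi>) = \<xi>" "u (op_adj I u \<xi>) = \<xi>"
    using inv assms(3) by (metis op_mult_apply op_one_apply)+
  note m = bounded_op_closed[OF u assms(3)] bounded_op_closed[OF op_adj_closed[OF u] assms(3)]
  have "l2_inner I (u \<xi>) (u \<xi>) = l2_inner I \<xi> \<xi>"
    by (simp add: op_adj_inner[OF u assms(3) m(1)] ap)
  then show "l2_norm I (u \<xi>) = l2_norm I \<xi>"
    unfolding l2_inner_self[OF m(1)] l2_inner_self[OF assms(3)] of_real_eq_iff
    by (simp add: power2_eq_iff_nonneg)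
  have "l2_inner I (op_adj I u \<xi>) (op_adj I u \<xi>) = l2_inner I \<xi> \<xi>"
    by (simp add: op_adj_inner'[OF u assms(3) m(2)] ap)
  then show "l2_norm I (op_adj I u \<xi>) = l2_norm I \<xi>"
    unfolding l2_inner_self[OF m(2)] l2_inner_self[OF assms(3)] of_real_eq_iff
    by (simp add: power2_eq_iff_nonneg)
  show "u (op_adj I u \<xi>) = \<xi>" by (rule ap)
qed

context group
begin

lemma left_regular_unitary:
  assumes H: "subgroup H G" and s: "s \<in> H"
  shows "left_regular G s \<in> carrier (unitary_group (carrier G) (group_vna G H))"
  using left_regular_in_group_vna[OF H s] subgroup.mem_carrier[OF H s]
  by (simp add: unitary_group_def left_regular_adj left_regular_mult left_regular_one)

text \<open>
  At a basis vector $\delta_h$ the coefficient is the conjugate of $\eta(sh)$, which tends to zero because \<open>\<eta>\<close> is square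
  summable.
\<close>

lemma left_regular_weakly_null:
  assumes H: "subgroup H G" and \<xi>: "\<xi> \<in> l2 (carrier G)" and \<eta>: "\<eta> \<in> l2 (carrier G)"
  shows "((\<lambda>s. l2_inner (carrier G) (left_regular G s \<xi>) \<eta>) \<longlongrightarrow> 0) (cofinite_on H)"
proof -
  let ?I = "carrier G"
  let ?p = "\<lambda>s \<xi>. cmod (l2_inner ?I (left_regular G s \<xi>) \<eta>)"
  have "((\<lambda>s. ?p s \<xi>) \<longlongrightarrow> 0) (cofinite_on H)"
  proof (rule l2_seminorms_tendsto_zero[where p = ?p and B = UNIV and I = ?I and K = "l2_norm ?I \<eta>"])
    have "l2_seminorm ?I (l2_norm ?I \<eta>) (?p s)" if "s \<in> H" for s
    proof -
      have s: "s \<in> ?I" using subgroup.mem_carrier[OF H that] .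
      note b = left_regular_closed[OF s]
      show ?thesis
        unfolding l2_seminorm_def
        using cauchy_schwarz[OF bounded_op_closed[OF b] \<eta>]
        by (simp add: bounded_op_add[OF b] bounded_op_scale[OF b] l2_inner_scale_left norm_mult
            l2_inner_add_left[OF bounded_op_closed[OF b] bounded_op_closed[OF b] \<eta>]
            norm_triangle_ineq l2_norm_left_regular[OF s] mult.commute)
    qed
    then show "\<forall>\<^sub>F s in cofinite_on H. l2_seminorm ?I (l2_norm ?I \<eta>) (?p s)"
      by (rule eventually_mem_cofinite_on)
    fix h assume h: "h \<in> ?I"
    have "filterlim (\<lambda>s. s \<otimes> h) (cofinite_on ?I) (cofinite_on H)"
      using h subgroup.mem_carrier[OF H] by (intro filterlim_cofinite_on) (auto intro!: inj_onI)
    then have "((\<lambda>s. \<eta> (s \<otimes> h)) \<longlongrightarrow> 0) (cofinite_on H)"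
      by (rule filterlim_compose[OF l2_tendsto_zero[OF \<eta>]])
    then have "((\<lambda>s. cmod (\<eta> (s \<otimes> h))) \<longlongrightarrow> 0) (cofinite_on H)"
      by (rule tendsto_norm_zero)
    moreover have "\<forall>\<^sub>F s in cofinite_on H. cmod (\<eta> (s \<otimes> h)) = ?p s (delta h)"
      using h subgroup.mem_carrier[OF H]
      by (intro eventually_mem_cofinite_on) (simp add: left_regular_delta l2_inner_delta)
    ultimately show "((\<lambda>s. ?p s (delta h)) \<longlongrightarrow> 0) (cofinite_on H)"
      by (rule Lim_transform_eventually)
  qed (use \<xi> in auto)
  then show ?thesis by (rule tendsto_norm_zero_cancel)
qed

text \<open>
  The operators $\lambda_s$ are contractions and tend weakly to zero, hence ultraweakly; an element of the
  predual is ultraweakly continuous and carries this to a limit of scalars.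
\<close>

lemma almost_orthonormal_left_regular:
  assumes H: "subgroup H G" and inf: "infinite H"
  shows "almost_orthonormal (carrier G) (group_vna G H) (left_regular G ` H)"
  unfolding almost_orthonormal_def
proof (intro conjI ballI allI impI)
  let ?I = "carrier G" and ?A = "group_vna G H"
  show "infinite (left_regular G ` H)"
    using inf finite_imageD[OF _ inj_on_subset[OF left_regular_inj subgroup.subset[OF H]]] by blast
  show "left_regular G ` H \<subseteq> carrier (unitary_group ?I ?A)"
    using left_regular_unitary[OF H] by blast
  fix \<phi> and \<epsilon> :: real assume \<phi>: "\<phi> \<in> predual ?I ?A" and "0 < \<epsilon>"
  \<comment> \<open>The zero operator, written so that linearity gives its image under a functional directly.\<close>
  define Z where "Z = op_scale ?I 0 (op_one ?I)"
  have Z: "Z \<in> ?A" unfolding Z_def by (intro group_vna_scale group_vna_one H)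
  have Z_apply: "l2_inner ?I (Z \<xi>) \<eta> = 0" if "\<xi> \<in> l2 ?I" for \<xi> \<eta>
    using that by (simp add: Z_def op_scale_def l2_inner_def)
  have "\<forall>\<^sub>F s in cofinite_on H. left_regular G s \<in> bounded_ops ?I \<and>
      (\<forall>\<xi>\<in>l2 ?I. l2_norm ?I (left_regular G s \<xi>) \<le> 1 * l2_norm ?I \<xi>)"
    using subgroup.mem_carrier[OF H]
    by (intro eventually_mem_cofinite_on) (simp add: left_regular_closed l2_norm_left_regular)
  then have "limitin (ultraweak_topology ?I) (left_regular G) Z (cofinite_on H)"
    by (rule limitin_ultraweak_topology)
      (use group_vna_bounded[OF H Z] left_regular_weakly_null[OF H] Z_apply cofinite_on_neq_bot[OF inf] in simp_all)
  then have "limitin (subtopology (ultraweak_topology ?I) ?A) (left_regular G) Z (cofinite_on H)"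
    using Z left_regular_in_group_vna[OF H] by (simp add: limitin_subtopology eventually_mem_cofinite_on)
  then have "limitin euclidean (\<phi> \<circ> left_regular G) (\<phi> Z) (cofinite_on H)"
    using \<phi> by (intro continuous_map_limit) (auto simp: predual_def)
  moreover have "\<phi> Z = 0"
    using \<phi> group_vna_one[OF H] by (simp add: predual_def functional_on_def Z_def)
  ultimately have "((\<lambda>s. \<phi> (left_regular G s)) \<longlongrightarrow> 0) (cofinite_on H)"
    by (simp add: o_def)
  then have "\<forall>\<^sub>F s in cofinite_on H. cmod (\<phi> (left_regular G s)) < \<epsilon>"
    using \<open>0 < \<epsilon>\<close> tendstoD[of "\<lambda>s. \<phi> (left_regular G s)" 0 "cofinite_on H" \<epsilon>] by simp
  then obtain F where F: "finite F" "F \<subseteq> H" "\<forall>s\<in>H - F. cmod (\<phi> (left_regular G s)) < \<epsilon>"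
    unfolding eventually_cofinite_on_iff_ex by blast
  have "cmod (\<phi> u) \<le> \<epsilon>" if u: "u \<in> left_regular G ` H - left_regular G ` F" for u
  proof -
    obtain s where "s \<in> H - F" "u = left_regular G s" using u by blast
    then show ?thesis using F(3) less_imp_le by blast
  qed
  then show "\<exists>F. finite F \<and> F \<subseteq> left_regular G ` H \<and> (\<forall>u\<in>left_regular G ` H - F. cmod (\<phi> u) \<le> \<epsilon>)"
    using F(1,2) by (intro exI[of _ "left_regular G ` F"]) auto
qed

lemma subgroup_left_regular:
  assumes H: "subgroup H G"
  shows "subgroup (left_regular G ` H) (unitary_group (carrier G) (group_vna G H))"
proof
  let ?I = "carrier G" and ?U = "unitary_group (carrier G) (group_vna G H)"
  have mult: "x \<otimes>\<^bsub>?U\<^esub> y = op_mult ?I x y" and one: "\<one>\<^bsub>?U\<^esub> = op_one ?I" for x y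
    by (simp_all add: unitary_group_def)
  note c = subgroup.mem_carrier[OF H]
  show "left_regular G ` H \<subseteq> carrier ?U" using left_regular_unitary[OF H] by blast
  show "\<one>\<^bsub>?U\<^esub> \<in> left_regular G ` H"
    using subgroup.one_closed[OF H] by (auto simp: one left_regular_one[symmetric])
  show "x \<otimes>\<^bsub>?U\<^esub> y \<in> left_regular G ` H" if "x \<in> left_regular G ` H" "y \<in> left_regular G ` H" for x y
    using that c subgroup.m_closed[OF H] by (auto simp: mult left_regular_mult)
  fix x assume "x \<in> left_regular G ` H"
  then obtain s where s: "s \<in> H" "x = left_regular G s" by blast
  have "inv\<^bsub>?U\<^esub> x = left_regular G (inv s)"
    unfolding m_inv_def[of ?U]
  proof (rule the_equality)
    show "left_regular G (inv s) \<in> carrier ?U \<and>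
        x \<otimes>\<^bsub>?U\<^esub> left_regular G (inv s) = \<one>\<^bsub>?U\<^esub> \<and> left_regular G (inv s) \<otimes>\<^bsub>?U\<^esub> x = \<one>\<^bsub>?U\<^esub>"
      using left_regular_unitary[OF H subgroup.m_inv_closed[OF H s(1)]] c[OF s(1)]
      by (simp add: s(2) mult one left_regular_mult left_regular_one)
  next
    fix y assume y: "y \<in> carrier ?U \<and> x \<otimes>\<^bsub>?U\<^esub> y = \<one>\<^bsub>?U\<^esub> \<and> y \<otimes>\<^bsub>?U\<^esub> x = \<one>\<^bsub>?U\<^esub>"
    then have yb: "y \<in> bounded_ops ?I" and xy: "op_mult ?I x y = op_one ?I"
      using group_vna_bounded[OF H] by (auto simp: unitary_group_def)
    have sb: "left_regular G (inv s) \<in> bounded_ops ?I" using c[OF s(1)] by (simp add: left_regular_closed)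
    have "y = op_mult ?I (op_mult ?I (left_regular G (inv s)) x) y"
      using c[OF s(1)] by (simp add: s(2) left_regular_mult left_regular_one op_mult_one_left[OF yb])
    also have "\<dots> = op_mult ?I (left_regular G (inv s)) (op_one ?I)"
      by (simp add: op_mult_assoc[OF yb] xy)
    finally show "y = left_regular G (inv s)" by (simp add: op_mult_one_right[OF sb])
  qed
  then show "inv\<^bsub>?U\<^esub> x \<in> left_regular G ` H"
    using subgroup.m_inv_closed[OF H s(1)] by simp
qed

end

section \<open>The mixing defect\<close>

lemma l2_norm_le_sum:
  assumes "finite D" "D \<subseteq> I" "\<And>i. i \<in> I - D \<Longrightarrow> \<xi> i = 0"
  shows "l2_norm I \<xi> \<le> (\<Sum>i\<in>D. cmod (\<xi> i))"
proof -
  have "(\<Sum>\<^sub>\<infinity>i\<in>I. (cmod (\<xi> i))\<^sup>2) = (\<Sum>\<^sub>\<infinity>i\<in>D. (cmod (\<xi> i))\<^sup>2)"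
    using assms by (intro infsum_cong_neutral) auto
  then have "l2_norm I \<xi> = L2_set (\<lambda>i. cmod (\<xi> i)) D"
    using assms(1) by (simp add: l2_norm_def L2_set_def)
  also have "\<dots> \<le> (\<Sum>i\<in>D. cmod (\<xi> i))" by (rule L2_set_le_sum) simp
  finally show ?thesis .
qed

context group
begin

text \<open>
  Condition (2). A malnormal subgroup \<open>H\<close> has trivial intersections $gHg^{-1} \cap H$ for \<open>g\<close> outside \<open>H\<close>; here
  the corresponding sets are only required to be finite.
\<close>

definition malnormal_at_infinity :: "'a set \<Rightarrow> bool" where
  "malnormal_at_infinity H \<longleftrightarrow>
     (\<forall>C. finite C \<and> C \<subseteq> carrier G - H \<longrightarrow>
       (\<exists>E. finite E \<and> E \<subseteq> H \<and> (\<forall>s\<in>H - E. \<forall>g\<in>C. \<forall>h\<in>C. g \<otimes> s \<otimes> h \<notin> H)))"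

abbreviation subgroup_mixing_defect :: "'a set \<Rightarrow> 'a op \<Rightarrow> 'a op \<Rightarrow> 'a op \<Rightarrow> real" where
  "subgroup_mixing_defect H \<equiv>
     mixing_defect (carrier G) (group_trace G) (group_vna G (carrier G)) (group_vna G H)"

text \<open>
  Applying everything to $\delta_1$ turns the defect into the norm of an explicit vector.
\<close>

lemma mixing_defect_eq:
  fixes H
  defines "E \<equiv> cond_exp (carrier G) (group_trace G) (group_vna G (carrier G)) (group_vna G H)"
  assumes H: "subgroup H G" and u: "u \<in> carrier (unitary_group (carrier G) (group_vna G H))"
    and x: "x \<in> group_vna G (carrier G)" and y: "y \<in> group_vna G (carrier G)"
  shows "subgroup_mixing_defect H u x y = l2_norm (carrier G)
    (\<lambda>g. restrict_vec H (u (x (op_adj (carrier G) u (y (delta \<one>))))) g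
      - E x (restrict_vec H (y (delta \<one>))) g)"
proof -
  let ?I = "carrier G" and ?M = "group_vna G (carrier G)" and ?A = "group_vna G H"
  have uA: "u \<in> ?A" using u by (simp add: unitary_group_def)
  then have uM: "u \<in> ?M" using group_vna_mono[OF H subgroup_self subgroup.subset[OF H]] by blast
  let ?W = "op_mult ?I (op_mult ?I (op_mult ?I u x) (op_adj ?I u)) y"
  have W: "?W \<in> ?M"
    by (intro group_vna_mult[OF subgroup_self] group_vna_adj[OF subgroup_self] uM x y)
  note bounded = group_vna_bounded[OF H] group_vna_bounded[OF subgroup_self]
  note E_in = cond_exp_in[OF H, folded E_def] and E_delta = cond_exp_delta[OF H, folded E_def]
  have Eb: "E ?W \<in> bounded_ops ?I" "op_mult ?I (E x) (E y) \<in> bounded_ops ?I"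
    by (intro bounded(1) E_in W x y op_mult_closed)+
  have d: "delta \<one> \<in> l2 ?I" by (simp add: delta_l2)
  have "subgroup_mixing_defect H u x y
      = l2_norm ?I (op_diff ?I (E ?W) (op_mult ?I (E x) (E y)) (delta \<one>))"
    unfolding mixing_defect_def E_def[symmetric]
    by (rule norm2_group_trace[OF op_diff_closed[OF Eb]])
  also have "op_diff ?I (E ?W) (op_mult ?I (E x) (E y)) (delta \<one>)
      = (\<lambda>g. restrict_vec H (?W (delta \<one>)) g - E x (restrict_vec H (y (delta \<one>))) g)"
    by (simp add: op_diff_def d op_mult_apply[OF d, of "E x" "E y"] E_delta[OF W] E_delta[OF y])
  also have "?W (delta \<one>) = u (x (op_adj ?I u (y (delta \<one>))))"
    by (simp add: op_mult_apply d bounded_op_closed[OF bounded(2)[OF y]]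
        bounded_op_closed[OF op_adj_closed[OF bounded(2)[OF uM]]])
  finally show ?thesis .
qed

text \<open>
  The entries of \<open>x\<close> with both indices in \<open>H\<close> are values of its vector on \<open>H\<close>.
\<close>

lemma restrict_off_diagonal_zero:
  assumes H: "subgroup H G" and x: "x \<in> group_vna G (carrier G)"
    and off: "\<And>g. g \<in> H \<Longrightarrow> x (delta \<one>) g = 0" and \<xi>: "\<xi> \<in> l2 (carrier G)"
  shows "restrict_vec H (x (restrict_vec H \<xi>)) = (\<lambda>g. 0)"
proof
  fix g
  show "restrict_vec H (x (restrict_vec H \<xi>)) g = 0"
  proof (cases "g \<in> H")
    case True
    then have g: "g \<in> carrier G" using subgroup.mem_carrier[OF H] by blast
    have "x (delta k) g * restrict_vec H \<xi> k = 0" if k: "k \<in> carrier G" for k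
    proof (cases "k \<in> H")
      case True
      then have "g \<otimes> inv k \<in> H"
        using \<open>g \<in> H\<close> subgroup.m_closed[OF H] subgroup.m_inv_closed[OF H] by blast
      then show ?thesis using group_vna_entry[OF subgroup_self x g k] off by simp
    qed (simp add: restrict_vec_apply)
    then have "x (restrict_vec H \<xi>) g = 0"
      using bounded_op_eq_infsum[OF group_vna_bounded[OF subgroup_self x] restrict_vec_closed[OF \<xi>] g]
      by (simp add: infsum_0)
    then show ?thesis by (simp add: restrict_vec_apply)
  qed (simp add: restrict_vec_apply)
qed

text \<open>
  Split \<open>x\<close> into \<open>z + a\<close> with $a = E(x)$. Since \<open>u\<close> commutes with \<open>a\<close>, the part of $u x u^* y$ coming from \<open>a\<close>
  is $a y$, with expectation $E(x)E(y)$. In the remaining part the outer \<open>u\<close> commutes with the projection onto \<open>H\<close> and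
  is isometric, and the component of \<open>y\<close> on \<open>H\<close> is lost because \<open>z\<close> has no entries within \<open>H\<close>.
\<close>

lemma mixing_defect_off_diagonal:
  fixes H
  defines "E \<equiv> cond_exp (carrier G) (group_trace G) (group_vna G (carrier G)) (group_vna G H)"
  assumes H: "subgroup H G" and comm: "\<And>s t. s \<in> H \<Longrightarrow> t \<in> H \<Longrightarrow> s \<otimes> t = t \<otimes> s"
    and u: "u \<in> carrier (unitary_group (carrier G) (group_vna G H))"
    and x: "x \<in> group_vna G (carrier G)" and y: "y \<in> group_vna G (carrier G)"
  shows "subgroup_mixing_defect H u x y = l2_norm (carrier G)
    (restrict_vec H (op_diff (carrier G) x (E x) (op_adj (carrier G) u (restrict_vec (- H) (y (delta \<one>))))))"
proof -
  let ?I = "carrier G" and ?M = "group_vna G (carrier G)" and ?A = "group_vna G H" and ?P = "restrict_vec H"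
  define a where "a = E x"
  define z where "z = op_diff ?I x a"
  define \<eta> where "\<eta> = y (delta \<one>)"
  define v where "v = op_adj ?I u"
  have A_M: "?A \<subseteq> ?M" by (rule group_vna_mono[OF H subgroup_self subgroup.subset[OF H]])
  have aA: "a \<in> ?A" unfolding a_def E_def by (rule cond_exp_in[OF H x])
  have uA: "u \<in> ?A" using u by (simp add: unitary_group_def)
  have vA: "v \<in> ?A" unfolding v_def by (rule group_vna_adj[OF H uA])
  have bx: "x \<in> bounded_ops ?I" and byd: "y \<in> bounded_ops ?I" using group_vna_bounded[OF subgroup_self] x y by auto
  have ba: "a \<in> bounded_ops ?I" and bu: "u \<in> bounded_ops ?I" and bv: "v \<in> bounded_ops ?I"
    using group_vna_bounded[OF H] aA uA vA by auto
  have zM: "z \<in> ?M"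
    unfolding z_def op_diff_eq[OF ba] using A_M aA x
    by (intro group_vna_add[OF subgroup_self] group_vna_scale[OF subgroup_self]) auto
  then have bz: "z \<in> bounded_ops ?I" by (rule group_vna_bounded[OF subgroup_self])
  have d: "delta \<one> \<in> l2 ?I" by (simp add: delta_l2)
  have \<eta>: "\<eta> \<in> l2 ?I" unfolding \<eta>_def by (rule bounded_op_closed[OF byd d])
  note mem = \<eta> bounded_op_closed[OF bx] bounded_op_closed[OF ba] bounded_op_closed[OF bu]
    bounded_op_closed[OF bv] bounded_op_closed[OF bz] restrict_vec_closed
  have P: "b (?P \<xi>) = ?P (b \<xi>)" if "b \<in> ?A" "\<xi> \<in> l2 ?I" for b \<xi>
    by (rule group_vna_restrict[OF H that subgroup_left_mult_mem[OF H]])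
  have z_off: "z (delta \<one>) g = 0" if "g \<in> H" for g
    using that cond_exp_delta[OF H x, folded E_def] d by (simp add: z_def op_diff_def a_def restrict_vec_apply)
  have u_v: "u (v \<xi>) = \<xi>" if "\<xi> \<in> l2 ?I" for \<xi>
    unfolding v_def by (rule unitary_adj_apply[OF u _ that]) (use group_vna_bounded[OF H] in auto)
  have "op_mult ?I u a = op_mult ?I a u"
    by (rule group_vna_commute[OF H comm uA aA])
  then have u_a: "u (a \<xi>) = a (u \<xi>)" if "\<xi> \<in> l2 ?I" for \<xi>
    using that by (metis op_mult_apply)
  have x_split: "x \<xi> = (\<lambda>g. z \<xi> g + a \<xi> g)" if "\<xi> \<in> l2 ?I" for \<xi>
    using that by (simp add: z_def op_diff_def)
  have "u (x (v \<eta>)) = (\<lambda>g. u (z (v \<eta>)) g + u (a (v \<eta>)) g)"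
    by (simp add: x_split bounded_op_add[OF bu] mem)
  also have "u (a (v \<eta>)) = a \<eta>"
    by (simp add: u_a u_v mem)
  finally have "(\<lambda>g. ?P (u (x (v \<eta>))) g - a (?P \<eta>) g) = ?P (u (z (v \<eta>)))"
    by (simp add: P[OF aA \<eta>] restrict_vec_linear)
  also have "\<dots> = u (?P (z (v \<eta>)))"
    by (simp add: P[OF uA] mem)
  finally have "subgroup_mixing_defect H u x y = l2_norm ?I (u (?P (z (v \<eta>))))"
    unfolding mixing_defect_eq[OF H u x y, folded E_def] by (simp add: a_def v_def \<eta>_def)
  also have "\<dots> = l2_norm ?I (?P (z (v \<eta>)))"
    by (rule l2_norm_unitary[OF u]) (use group_vna_bounded[OF H] in \<open>auto simp: mem\<close>)
  also have "?P (z (v \<eta>)) = ?P (z (v (restrict_vec (- H) \<eta>)))"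
  proof -
    have "\<eta> = (\<lambda>g. restrict_vec (- H) \<eta> g + ?P \<eta> g)"
      by (auto simp: restrict_vec_apply)
    then have "z (v \<eta>) = z (v (\<lambda>g. restrict_vec (- H) \<eta> g + ?P \<eta> g))" by simp
    also have "\<dots> = (\<lambda>g. z (v (restrict_vec (- H) \<eta>)) g + z (v (?P \<eta>)) g)"
      by (simp add: bounded_op_add[OF bv] bounded_op_add[OF bz] mem)
    finally show ?thesis
      using restrict_off_diagonal_zero[OF H zM z_off, of "v \<eta>"]
      by (simp add: restrict_vec_linear P[OF vA \<eta>] mem)
  qed
  finally show ?thesis by (simp add: a_def z_def \<eta>_def v_def)
qed

section \<open>Decay along almost orthonormal sets\<close>

text \<open>
  The coefficient of $x u^*\delta_h$ at \<open>k\<close> is the conjugate of the coefficient of $u x^*\delta_k$ at \<open>h\<close>, and the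
  latter operator lies in the group algebra, so this is its vector at $hk^{-1}$. As \<open>k\<close> runs through \<open>H\<close>, the
  element $hk^{-1}$ runs through the coset \<open>h H\<close>. The transposition moves \<open>u\<close> to the left of a fixed vector,
  where its isometry can be used.
\<close>

lemma l2_norm_restrict_transpose:
  assumes H: "subgroup H G" and x: "x \<in> group_vna G (carrier G)" and u: "u \<in> group_vna G H"
    and h: "h \<in> carrier G"
  shows "l2_norm (carrier G) (restrict_vec H (x (op_adj (carrier G) u (delta h))))
    = l2_norm (carrier G) (restrict_vec {j. inv h \<otimes> j \<in> H} (u (op_adj (carrier G) x (delta \<one>))))"
proof -
  let ?I = "carrier G" and ?B = "{j. inv h \<otimes> j \<in> H}"
  have uM: "u \<in> group_vna G ?I"
    using u group_vna_mono[OF H subgroup_self subgroup.subset[OF H]] by blast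
  have bx: "x \<in> bounded_ops ?I" and bu: "u \<in> bounded_ops ?I"
    using group_vna_bounded[OF subgroup_self] x uM by auto
  have ux: "op_mult ?I u (op_adj ?I x) \<in> group_vna G ?I"
    by (intro group_vna_mult[OF subgroup_self] group_vna_adj[OF subgroup_self] uM x)
  note mem = bounded_op_closed[OF op_adj_closed[OF bx]] bounded_op_closed[OF op_adj_closed[OF bu]]
    bounded_op_closed[OF bu] bounded_op_closed[OF bx] delta_l2 h
  have entry: "x (op_adj ?I u (delta h)) k = cnj (u (op_adj ?I x (delta \<one>)) (h \<otimes> inv k))"
    if k: "k \<in> ?I" for k
  proof -
    have "x (op_adj ?I u (delta h)) k = l2_inner ?I (x (op_adj ?I u (delta h))) (delta k)"
      by (simp add: l2_inner_delta k)
    also have "\<dots> = l2_inner ?I (delta h) (u (op_adj ?I x (delta k)))"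
      by (simp add: op_adj_inner[OF bx] op_adj_inner'[OF bu] mem k)
    also have "\<dots> = cnj (op_mult ?I u (op_adj ?I x) (delta k) h)"
      by (simp add: l2_inner_delta h op_mult_apply delta_l2 k)
    also have "\<dots> = cnj (op_mult ?I u (op_adj ?I x) (delta \<one>) (h \<otimes> inv k))"
      by (subst group_vna_entry[OF subgroup_self ux h k]) simp
    finally show ?thesis by (simp add: op_mult_apply delta_l2)
  qed
  have bij: "bij_betw (\<lambda>k. h \<otimes> inv k) (?I \<inter> H) (?I \<inter> ?B)"
  proof (rule bij_betw_byWitness[where f' = "\<lambda>j. inv j \<otimes> h"])
    show "(\<lambda>k. h \<otimes> inv k) ` (?I \<inter> H) \<subseteq> ?I \<inter> ?B"
      using h subgroup.m_inv_closed[OF H] by (auto simp: mult_inv_cancel_left)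
    show "(\<lambda>j. inv j \<otimes> h) ` (?I \<inter> ?B) \<subseteq> ?I \<inter> H"
    proof clarify
      fix j assume j: "j \<in> ?I" "inv h \<otimes> j \<in> H"
      then show "inv j \<otimes> h \<in> ?I \<inter> H"
        using h subgroup.m_inv_closed[OF H j(2)] by (simp add: inv_mult_group)
    qed
  qed (use h in \<open>auto simp: inv_mult_group m_assoc mult_inv_cancel_left\<close>)
  have "(l2_norm ?I (restrict_vec H (x (op_adj ?I u (delta h)))))\<^sup>2
      = (\<Sum>\<^sub>\<infinity>k\<in>?I \<inter> H. (cmod (u (op_adj ?I x (delta \<one>)) (h \<otimes> inv k)))\<^sup>2)"
    unfolding l2_norm_restrict_vec by (rule infsum_cong) (simp add: entry)
  also have "\<dots> = (\<Sum>\<^sub>\<infinity>j\<in>?I \<inter> ?B. (cmod (u (op_adj ?I x (delta \<one>)) j))\<^sup>2)"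
    by (rule infsum_reindex_bij_betw[OF bij])
  also have "\<dots> = (l2_norm ?I (restrict_vec ?B (u (op_adj ?I x (delta \<one>)))))\<^sup>2"
    by (simp add: l2_norm_restrict_vec)
  finally show ?thesis by (simp add: power2_eq_iff_nonneg)
qed

text \<open>
  The vector $u\delta_g$ is supported on \<open>H g\<close>. The set \<open>E\<close> obtained for the pair \<open>h\<close>, $g^{-1}$ confines the
  intersection of \<open>H g\<close> with \<open>h H\<close> to the finite set \<open>h E\<close>, so the norm is at most a finite sum of matrix
  coefficients of \<open>u\<close>.
\<close>

lemma restrict_left_coset_tendsto_zero:
  assumes H: "subgroup H G" and mal: "malnormal_at_infinity H"
    and S: "almost_orthonormal (carrier G) (group_vna G H) S"
    and g: "g \<in> carrier G - H" and h: "h \<in> carrier G - H"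
  shows "((\<lambda>u. l2_norm (carrier G) (restrict_vec {j. inv h \<otimes> j \<in> H} (u (delta g)))) \<longlongrightarrow> 0)
    (cofinite_on S)"
proof -
  let ?I = "carrier G" and ?A = "group_vna G H" and ?B = "{j. inv h \<otimes> j \<in> H}"
  have gh: "g \<in> ?I" "h \<in> ?I" using g h by auto
  have "inv g \<notin> H"
    using g subgroup.m_inv_closed[OF H, of "inv g"] by auto
  then have "finite {h, inv g} \<and> {h, inv g} \<subseteq> ?I - H" using g h by auto
  then obtain E where E: "finite E" "E \<subseteq> H" "\<forall>s\<in>H - E. \<forall>a\<in>{h, inv g}. \<forall>b\<in>{h, inv g}. a \<otimes> s \<otimes> b \<notin> H"
    using mal unfolding malnormal_at_infinity_def by meson
  let ?D = "(\<lambda>s. h \<otimes> s) ` E"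
  have D: "finite ?D" "?D \<subseteq> ?I"
    using E gh subgroup.mem_carrier[OF H] by auto
  have A_bounded: "?A \<subseteq> bounded_ops ?I" using group_vna_bounded[OF H] by blast
  have le: "l2_norm ?I (restrict_vec ?B (u (delta g))) \<le> (\<Sum>j\<in>?D. cmod (l2_inner ?I (u (delta g)) (delta j)))"
    if u: "u \<in> S" for u
  proof -
    have uA: "u \<in> ?A" using u S by (auto simp: almost_orthonormal_def unitary_group_def)
    have "restrict_vec ?B (u (delta g)) j = 0" if j: "j \<in> ?I - ?D" for j
    proof (cases "j \<in> ?B")
      case True
      have jh: "h \<otimes> (inv h \<otimes> j) = j" using j gh by (simp add: mult_inv_cancel_left)
      then have "inv h \<otimes> j \<in> H - E" using True j by force
      then have "h \<otimes> (inv h \<otimes> j) \<otimes> inv g \<notin> H" using E(3) by blast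
      then have "u (delta \<one>) (j \<otimes> inv g) = 0"
        unfolding jh by (rule group_vna_support[OF H uA])
      then show ?thesis using group_vna_entry[OF H uA, of j g] j gh by (simp add: restrict_vec_apply)
    qed (simp add: restrict_vec_apply)
    then have "l2_norm ?I (restrict_vec ?B (u (delta g))) \<le> (\<Sum>j\<in>?D. cmod (restrict_vec ?B (u (delta g)) j))"
      by (rule l2_norm_le_sum[OF D])
    also have "\<dots> \<le> (\<Sum>j\<in>?D. cmod (l2_inner ?I (u (delta g)) (delta j)))"
      using D(2) by (intro sum_mono) (auto simp: restrict_vec_apply l2_inner_delta subset_iff)
    finally show ?thesis .
  qed
  have "((\<lambda>u. \<Sum>j\<in>?D. cmod (l2_inner ?I (u (delta g)) (delta j))) \<longlongrightarrow> 0) (cofinite_on S)"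
  proof (rule tendsto_null_sum)
    fix j assume "j \<in> ?D"
    then have "j \<in> ?I" using D(2) by blast
    then show "((\<lambda>u. cmod (l2_inner ?I (u (delta g)) (delta j))) \<longlongrightarrow> 0) (cofinite_on S)"
      by (intro tendsto_norm_zero almost_orthonormal_coefficient[OF S A_bounded] delta_l2 gh)
  qed
  moreover have "\<forall>\<^sub>F u in cofinite_on S.
      norm (l2_norm ?I (restrict_vec ?B (u (delta g)))) \<le> (\<Sum>j\<in>?D. cmod (l2_inner ?I (u (delta g)) (delta j)))"
    using le by (intro eventually_mem_cofinite_on) simp
  ultimately show ?thesis by (rule Lim_null_comparison[rotated])
qed

text \<open>
  The density lemma \<open>l2_seminorms_tendsto_zero\<close> is applied twice: to the dependence on \<open>\<eta>\<close>, with bound \<open>K\<close>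
  coming from \<open>z\<close>, and, after the transposition at a basis vector, to the dependence on \<open>\<zeta>\<close>, with bound 1.
\<close>

theorem mixing_defect_tendsto_zero:
  assumes H: "subgroup H G" and comm: "\<And>s t. s \<in> H \<Longrightarrow> t \<in> H \<Longrightarrow> s \<otimes> t = t \<otimes> s"
    and mal: "malnormal_at_infinity H"
    and S: "almost_orthonormal (carrier G) (group_vna G H) S"
    and x: "x \<in> group_vna G (carrier G)" and y: "y \<in> group_vna G (carrier G)"
  shows "((\<lambda>u. subgroup_mixing_defect H u x y) \<longlongrightarrow> 0) (cofinite_on S)"
proof -
  let ?I = "carrier G" and ?M = "group_vna G (carrier G)" and ?A = "group_vna G H"
  define a where "a = cond_exp ?I (group_trace G) ?M ?A x"
  define z where "z = op_diff ?I x a"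
  define \<zeta> where "\<zeta> = op_adj ?I z (delta \<one>)"
  define \<eta> where "\<eta> = restrict_vec (- H) (y (delta \<one>))"
  have aA: "a \<in> ?A" unfolding a_def by (rule cond_exp_in[OF H x])
  have ba: "a \<in> bounded_ops ?I" by (rule group_vna_bounded[OF H aA])
  have aM: "a \<in> ?M" using aA group_vna_mono[OF H subgroup_self subgroup.subset[OF H]] by blast
  have zM: "z \<in> ?M"
    unfolding z_def op_diff_eq[OF ba]
    by (intro group_vna_add[OF subgroup_self] group_vna_scale[OF subgroup_self] aM x)
  then have bz: "z \<in> bounded_ops ?I" by (rule group_vna_bounded[OF subgroup_self])
  have d: "delta \<one> \<in> l2 ?I" by (simp add: delta_l2)
  have z_off: "z (delta \<one>) g = 0" if "g \<in> H" for g
    using that cond_exp_delta[OF H x] d by (simp add: z_def op_diff_def a_def restrict_vec_apply)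
  have \<zeta>: "\<zeta> \<in> l2 ?I" unfolding \<zeta>_def by (rule bounded_op_closed[OF op_adj_closed[OF bz] d])
  have \<zeta>_off: "\<zeta> g = 0" if "g \<notin> - H" for g
  proof -
    from that have gH: "g \<in> H" by simp
    then have g: "g \<in> ?I" using subgroup.mem_carrier[OF H] by blast
    have "\<zeta> g = cnj (z (delta g) \<one>)" unfolding \<zeta>_def by (rule op_adj_delta[OF bz one_closed g])
    then show ?thesis
      using group_vna_entry[OF subgroup_self zM one_closed g] z_off[OF subgroup.m_inv_closed[OF H gH]] g by simp
  qed
  have \<eta>: "\<eta> \<in> l2 ?I"
    unfolding \<eta>_def by (intro restrict_vec_closed bounded_op_closed[OF group_vna_bounded[OF subgroup_self y]] d)
  have A_bounded: "?A \<subseteq> bounded_ops ?I" using group_vna_bounded[OF H] by blast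
  have u_unitary: "u \<in> carrier (unitary_group ?I ?A)" if "u \<in> S" for u
    using that S by (auto simp: almost_orthonormal_def)
  have uA: "u \<in> ?A" if "u \<in> S" for u
    using u_unitary[OF that] by (simp add: unitary_group_def)
  have bu: "u \<in> bounded_ops ?I" if "u \<in> S" for u
    using uA[OF that] A_bounded by blast
  have delta_limit: "((\<lambda>u. l2_norm ?I (restrict_vec H (z (op_adj ?I u (delta h))))) \<longlongrightarrow> 0) (cofinite_on S)"
    if h: "h \<in> ?I - H" for h
  proof -
    let ?B = "{j. inv h \<otimes> j \<in> H}"
    \<comment> \<open>Written as the norm of one bounded operator, the quantity is a seminorm by a general lemma.\<close>
    let ?p = "\<lambda>u \<xi>. l2_norm ?I (op_mult ?I (coord_proj ?I ?B) u \<xi>)"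
    have p_eq: "?p u \<xi> = l2_norm ?I (restrict_vec ?B (u \<xi>))" if "u \<in> S" "\<xi> \<in> l2 ?I" for u \<xi>
      using that bounded_op_closed[OF bu] by (simp add: op_mult_apply coord_proj_apply)
    have "((\<lambda>u. ?p u \<zeta>) \<longlongrightarrow> 0) (cofinite_on S)"
    proof (rule l2_seminorms_tendsto_zero[where p = ?p and B = "- H" and I = ?I and K = 1])
      show "\<forall>\<^sub>F u in cofinite_on S. l2_seminorm ?I 1 (?p u)"
      proof (rule eventually_mem_cofinite_on, rule op_norm_seminorm)
        fix u \<xi> assume u: "u \<in> S"
        show "op_mult ?I (coord_proj ?I ?B) u \<in> bounded_ops ?I"
          by (rule op_mult_closed[OF coord_proj_closed bu[OF u]])
        assume \<xi>: "\<xi> \<in> l2 ?I"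
        have "?p u \<xi> \<le> l2_norm ?I (u \<xi>)"
          unfolding p_eq[OF u \<xi>] by (rule l2_norm_restrict_vec_le[OF bounded_op_closed[OF bu[OF u] \<xi>]])
        then show "?p u \<xi> \<le> 1 * l2_norm ?I \<xi>"
          by (simp add: l2_norm_unitary[OF u_unitary[OF u] A_bounded \<xi>])
      qed
      fix g assume "g \<in> - H" "g \<in> ?I"
      then have "((\<lambda>u. l2_norm ?I (restrict_vec ?B (u (delta g)))) \<longlongrightarrow> 0) (cofinite_on S)"
        by (intro restrict_left_coset_tendsto_zero[OF H mal S _ h]) auto
      moreover have "\<forall>\<^sub>F u in cofinite_on S. l2_norm ?I (restrict_vec ?B (u (delta g))) = ?p u (delta g)"
        using \<open>g \<in> ?I\<close> by (intro eventually_mem_cofinite_on) (simp add: p_eq delta_l2)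
      ultimately show "((\<lambda>u. ?p u (delta g)) \<longlongrightarrow> 0) (cofinite_on S)"
        by (rule Lim_transform_eventually)
    qed (use \<zeta> \<zeta>_off in auto)
    moreover have "\<forall>\<^sub>F u in cofinite_on S. ?p u \<zeta> = l2_norm ?I (restrict_vec H (z (op_adj ?I u (delta h))))"
      using h by (intro eventually_mem_cofinite_on)
        (simp add: p_eq \<zeta> l2_norm_restrict_transpose[OF H zM uA] \<zeta>_def[symmetric])
    ultimately show ?thesis by (rule Lim_transform_eventually)
  qed
  obtain K where K: "0 \<le> K" "\<And>\<xi>. \<xi> \<in> l2 ?I \<Longrightarrow> l2_norm ?I (z \<xi>) \<le> K * l2_norm ?I \<xi>"
    using bounded_op_bound[OF bz] by blast
  let ?p = "\<lambda>u \<xi>. l2_norm ?I (op_mult ?I (op_mult ?I (coord_proj ?I H) z) (op_adj ?I u) \<xi>)"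
  have p_eq: "?p u \<xi> = l2_norm ?I (restrict_vec H (z (op_adj ?I u \<xi>)))" if "u \<in> S" "\<xi> \<in> l2 ?I" for u \<xi>
    using that bounded_op_closed[OF op_adj_closed[OF bu]] bounded_op_closed[OF bz]
    by (simp add: op_mult_apply coord_proj_apply)
  have "((\<lambda>u. ?p u \<eta>) \<longlongrightarrow> 0) (cofinite_on S)"
  proof (rule l2_seminorms_tendsto_zero[where p = ?p and B = "- H" and I = ?I and K = K])
    show "\<forall>\<^sub>F u in cofinite_on S. l2_seminorm ?I K (?p u)"
    proof (rule eventually_mem_cofinite_on, rule op_norm_seminorm)
      fix u \<xi> assume u: "u \<in> S"
      show "op_mult ?I (op_mult ?I (coord_proj ?I H) z) (op_adj ?I u) \<in> bounded_ops ?I"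
        by (intro op_mult_closed coord_proj_closed bz op_adj_closed bu u)
      assume \<xi>: "\<xi> \<in> l2 ?I"
      have v\<xi>: "op_adj ?I u \<xi> \<in> l2 ?I" by (rule bounded_op_closed[OF op_adj_closed[OF bu[OF u]] \<xi>])
      have "?p u \<xi> \<le> l2_norm ?I (z (op_adj ?I u \<xi>))"
        unfolding p_eq[OF u \<xi>] by (rule l2_norm_restrict_vec_le[OF bounded_op_closed[OF bz v\<xi>]])
      also have "\<dots> \<le> K * l2_norm ?I (op_adj ?I u \<xi>)" by (rule K(2)[OF v\<xi>])
      finally show "?p u \<xi> \<le> K * l2_norm ?I \<xi>"
        by (simp add: l2_norm_unitary_adj[OF u_unitary[OF u] A_bounded \<xi>])
    qed
    fix h assume h: "h \<in> - H" "h \<in> ?I"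
    moreover have "\<forall>\<^sub>F u in cofinite_on S. l2_norm ?I (restrict_vec H (z (op_adj ?I u (delta h)))) = ?p u (delta h)"
      using \<open>h \<in> ?I\<close> by (intro eventually_mem_cofinite_on) (simp add: p_eq delta_l2)
    ultimately show "((\<lambda>u. ?p u (delta h)) \<longlongrightarrow> 0) (cofinite_on S)"
      using delta_limit by (auto intro: Lim_transform_eventually)
  qed (use \<eta> in \<open>auto simp: \<eta>_def restrict_vec_apply\<close>)
  moreover have "\<forall>\<^sub>F u in cofinite_on S. ?p u \<eta> = subgroup_mixing_defect H u x y"
    by (intro eventually_mem_cofinite_on)
      (simp add: p_eq \<eta> mixing_defect_off_diagonal[OF H comm u_unitary x y, folded a_def, folded z_def \<eta>_def])
  ultimately show ?thesis by (rule Lim_transform_eventually)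
qed

section \<open>The equivalence\<close>

text \<open>
  For \<open>g\<close> and \<open>h\<close> outside \<open>H\<close> the two expectations $E(\lambda_g)$ and $E(\lambda_h)$ vanish. If $gsh$ lies in
  \<open>H\<close>, the defect at $\lambda_{s^{-1}}$ is the norm of a basis vector; mixing with tolerance 1 therefore excludes all but finitely
  many such \<open>s\<close>.
\<close>

theorem malnormal_at_infinity_if_mixing:
  assumes H: "subgroup H G"
    and mix: "strongly_mixing_action (carrier G) (group_trace G) (group_vna G (carrier G)) (group_vna G H)
      (left_regular G ` H)"
  shows "malnormal_at_infinity H"
  unfolding malnormal_at_infinity_def
proof (intro allI impI)
  let ?I = "carrier G" and ?M = "group_vna G (carrier G)"
  fix C assume C: "finite C \<and> C \<subseteq> ?I - H"
  have fin: "finite {s \<in> H. g \<otimes> s \<otimes> h \<in> H}" if gh: "g \<in> C" "h \<in> C" for g h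
  proof -
    have g: "g \<in> ?I" "g \<notin> H" and h: "h \<in> ?I" "h \<notin> H" using gh C by auto
    have gM: "left_regular G g \<in> ?M" and hM: "left_regular G h \<in> ?M"
      using left_regular_in_group_vna[OF subgroup_self] g h by auto
    obtain F where F: "finite F" "\<forall>u\<in>left_regular G ` H - F.
        subgroup_mixing_defect H u (left_regular G g) (left_regular G h) < 1"
      using mix gM hM unfolding strongly_mixing_action_def by (meson zero_less_one)
    have "left_regular G (inv s) \<in> F" if s: "s \<in> H" "g \<otimes> s \<otimes> h \<in> H" for s
    proof (rule ccontr)
      assume "left_regular G (inv s) \<notin> F"
      have sI: "s \<in> ?I" and sH: "inv s \<in> H"
        using s(1) subgroup.mem_carrier[OF H] subgroup.m_inv_closed[OF H] by auto
      have less: "subgroup_mixing_defect H (left_regular G (inv s)) (left_regular G g) (left_regular G h) < 1"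
        using F(2) sH \<open>left_regular G (inv s) \<notin> F\<close> by blast
      define k where "k = inv s \<otimes> (g \<otimes> (s \<otimes> h))"
      have k: "k \<in> ?I" "k \<in> H"
        using s sH sI g h subgroup.m_closed[OF H sH s(2)] by (simp_all add: k_def m_assoc)
      have "left_regular G (inv s) (left_regular G g (op_adj ?I (left_regular G (inv s)) (left_regular G h (delta \<one>))))
          = delta k"
        using sI g h by (simp add: left_regular_adj left_regular_delta k_def)
      moreover have "restrict_vec H (delta k) = (delta k :: _ \<Rightarrow> complex)"
        using k(2) by (auto simp: restrict_vec_def delta_def)
      moreover have "restrict_vec H (left_regular G h (delta \<one>)) = (\<lambda>i. 0)"
        using h(2) unfolding left_regular_delta[OF h(1) one_closed] r_one[OF h(1)]
        by (auto simp: restrict_vec_def delta_def)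
      moreover have "cond_exp ?I (group_trace G) ?M (group_vna G H) (left_regular G g) (\<lambda>i. 0) = (\<lambda>i. 0)"
        using bounded_op_scale[OF group_vna_bounded[OF H cond_exp_in[OF H gM]] l2_zero, of 0] by simp
      ultimately have "subgroup_mixing_defect H (left_regular G (inv s)) (left_regular G g) (left_regular G h)
          = l2_norm ?I (delta k)"
        unfolding mixing_defect_eq[OF H left_regular_unitary[OF H sH] gM hM] by simp
      with less k(1) show False by (simp add: l2_norm_delta)
    qed
    then have "(\<lambda>s. left_regular G (inv s)) ` {s \<in> H. g \<otimes> s \<otimes> h \<in> H} \<subseteq> F" by blast
    moreover have "inj_on (\<lambda>s. left_regular G (inv s)) {s \<in> H. g \<otimes> s \<otimes> h \<in> H}"
    proof (rule inj_onI)
      fix s t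
      assume st: "s \<in> {s \<in> H. g \<otimes> s \<otimes> h \<in> H}" "t \<in> {s \<in> H. g \<otimes> s \<otimes> h \<in> H}"
        and eq: "left_regular G (inv s) = left_regular G (inv t)"
      have c: "s \<in> ?I" "t \<in> ?I" using st subgroup.mem_carrier[OF H] by auto
      have "inv s = inv t" by (rule inj_onD[OF left_regular_inj eq]) (simp_all add: c)
      then have "inv (inv s) = inv (inv t)" by (rule arg_cong)
      then show "s = t" unfolding inv_inv[OF c(1)] inv_inv[OF c(2)] .
    qed
    ultimately show ?thesis using finite_imageD[OF finite_subset[OF _ F(1)]] by blast
  qed
  let ?E = "\<Union>g\<in>C. \<Union>h\<in>C. {s \<in> H. g \<otimes> s \<otimes> h \<in> H}"
  have "finite ?E" using fin C by blast
  then show "\<exists>E. finite E \<and> E \<subseteq> H \<and> (\<forall>s\<in>H - E. \<forall>g\<in>C. \<forall>h\<in>C. g \<otimes> s \<otimes> h \<notin> H)"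
    by (intro exI[of _ ?E]) auto
qed

end

theorem theorem3p5:
  fixes \<Gamma> :: "('g, 'b) monoid_scheme" and \<Gamma>\<^sub>0 :: "'g set"
  assumes "group \<Gamma>" and "countable (carrier \<Gamma>)" and "infinite (carrier \<Gamma>)"
    and "subgroup \<Gamma>\<^sub>0 \<Gamma>" and "infinite \<Gamma>\<^sub>0" and "comm_group (\<Gamma>\<lparr>carrier := \<Gamma>\<^sub>0\<rparr>)"
  shows
    "let I = carrier \<Gamma>; \<tau> = group_trace \<Gamma>; M = group_vna \<Gamma> (carrier \<Gamma>); A = group_vna \<Gamma> \<Gamma>\<^sub>0;
         cond1 = strongly_mixing_action I \<tau> M A (left_regular \<Gamma> ` \<Gamma>\<^sub>0);
         cond2 = (\<forall>C. finite C \<and> C \<subseteq> carrier \<Gamma> - \<Gamma>\<^sub>0 \<longrightarrow>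
           (\<exists>E. finite E \<and> E \<subseteq> \<Gamma>\<^sub>0 \<and>
             (\<forall>g\<^sub>0\<in>\<Gamma>\<^sub>0 - E. \<forall>g\<in>C. \<forall>h\<in>C. g \<otimes>\<^bsub>\<Gamma>\<^esub> g\<^sub>0 \<otimes>\<^bsub>\<Gamma>\<^esub> h \<notin> \<Gamma>\<^sub>0)));
         cond3 = (\<forall>S. almost_orthonormal I A S \<longrightarrow>
           (\<forall>x\<in>M. \<forall>y\<in>M. \<forall>\<epsilon>>0. \<exists>F. finite F \<and> F \<subseteq> S \<and>
             (\<forall>u\<in>S - F. mixing_defect I \<tau> M A u x y < \<epsilon>)));
         cond4 = strongly_mixing I \<tau> M A
     in (cond1 \<longleftrightarrow> cond2) \<and> (cond2 \<longleftrightarrow> cond3) \<and> (cond3 \<longleftrightarrow> cond4)"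
proof -
  interpret group \<Gamma> by fact
  note H = \<open>subgroup \<Gamma>\<^sub>0 \<Gamma>\<close>
  define I where "I = carrier \<Gamma>"
  define \<tau> where "\<tau> = group_trace \<Gamma>"
  define M where "M = group_vna \<Gamma> (carrier \<Gamma>)"
  define A where "A = group_vna \<Gamma> \<Gamma>\<^sub>0"
  define cond1 where "cond1 = strongly_mixing_action I \<tau> M A (left_regular \<Gamma> ` \<Gamma>\<^sub>0)"
  define cond2 where "cond2 = (\<forall>C. finite C \<and> C \<subseteq> carrier \<Gamma> - \<Gamma>\<^sub>0 \<longrightarrow>
           (\<exists>E. finite E \<and> E \<subseteq> \<Gamma>\<^sub>0 \<and>
             (\<forall>g\<^sub>0\<in>\<Gamma>\<^sub>0 - E. \<forall>g\<in>C. \<forall>h\<in>C. g \<otimes>\<^bsub>\<Gamma>\<^esub> g\<^sub>0 \<otimes>\<^bsub>\<Gamma>\<^esub> h \<notin> \<Gamma>\<^sub>0)))"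
  define cond3 where "cond3 = (\<forall>S. almost_orthonormal I A S \<longrightarrow>
           (\<forall>x\<in>M. \<forall>y\<in>M. \<forall>\<epsilon>>0. \<exists>F. finite F \<and> F \<subseteq> S \<and>
             (\<forall>u\<in>S - F. mixing_defect I \<tau> M A u x y < \<epsilon>)))"
  define cond4 where "cond4 = strongly_mixing I \<tau> M A"
  note defs = I_def \<tau>_def M_def A_def
  have comm: "s \<otimes>\<^bsub>\<Gamma>\<^esub> t = t \<otimes>\<^bsub>\<Gamma>\<^esub> s" if "s \<in> \<Gamma>\<^sub>0" "t \<in> \<Gamma>\<^sub>0" for s t
    using comm_monoid.m_comm[OF comm_group.axioms(1)[OF \<open>comm_group (\<Gamma>\<lparr>carrier := \<Gamma>\<^sub>0\<rparr>)\<close>], of s t] that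
    by simp
  have "cond3" if "cond2"
    unfolding cond3_def
  proof (intro allI impI ballI)
    fix S x y and \<epsilon> :: real
    assume S: "almost_orthonormal I A S" and xy: "x \<in> M" "y \<in> M" and "0 < \<epsilon>"
    have "((\<lambda>u. mixing_defect I \<tau> M A u x y) \<longlongrightarrow> 0) (cofinite_on S)"
      unfolding defs using that S xy unfolding defs
      by (intro mixing_defect_tendsto_zero[OF H comm]) (simp_all add: malnormal_at_infinity_def cond2_def)
    then have "\<forall>\<^sub>F u in cofinite_on S. mixing_defect I \<tau> M A u x y < \<epsilon>"
      using \<open>0 < \<epsilon>\<close> by (rule order_tendstoD(2))
    then show "\<exists>F. finite F \<and> F \<subseteq> S \<and> (\<forall>u\<in>S - F. mixing_defect I \<tau> M A u x y < \<epsilon>)"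
      by (simp only: eventually_cofinite_on_iff_ex)
  qed
  moreover have "cond4" if "cond3"
    using that unfolding cond4_def cond3_def strongly_mixing_def strongly_mixing_action_def by blast
  moreover have "cond1" if "cond4"
    using that subgroup_left_regular[OF H] almost_orthonormal_left_regular[OF H \<open>infinite \<Gamma>\<^sub>0\<close>]
    unfolding cond4_def cond1_def strongly_mixing_def defs by blast
  moreover have "cond2" if "cond1"
    using malnormal_at_infinity_if_mixing[OF H] that
    unfolding cond1_def cond2_def malnormal_at_infinity_def defs by blast
  ultimately have "(cond1 \<longleftrightarrow> cond2) \<and> (cond2 \<longleftrightarrow> cond3) \<and> (cond3 \<longleftrightarrow> cond4)" by blast
  then show ?thesis
    unfolding cond1_def cond2_def cond3_def cond4_def defs Let_def .
qed

end
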